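(* Let $m=\mathfrak q+\mathfrak q^{-1}$ with $\mathfrak q\in\mathbb C^\times$, and let $M_1,M_2,M_3$ be three modules over the Temperley–Lieb algebras $\mathsf{TL}_{N_1}(m)$, $\mathsf{TL}_{N_2}(m)$ and $\mathsf{TL}_{N_3}(m)$, respectively. The tensor product $\times_f$ is equipped with an associator, i.e. there is a family of natural isomorphisms of $\mathsf{TL}_{N_1+N_2+N_3}(m)$-modules $$\alpha_{M_1,M_2,M_3}:(M_1\times_fM_2)\times_fM_3\xrightarrow{\ \cong\ }M_1\times_f(M_2\times_fM_3)$$ given explicitly, for $m_i\in M_i$, $a\in\mathsf{TL}_{N_1+N_2+N_3}(m)$, $b\in\mathsf{TL}_{N_1+N_2}(m)$, by $$a\otimes(b\otimes m_1\otimes m_2)\otimes m_3\mapsto a\cdot b\otimes\bigl(m_1\otimes(\mathbf1_{2+3}\otimes m_2\otimes m_3)\bigr),$$ where $\mathbf1_{2+3}$ is the identity of $\mathsf{TL}_{N_2+N_3}$ and $a\cdot b$ is the product of $a$ with the image of $b$ under the standard embedding $\mathsf{TL}_{N_1+N_2}\to\mathsf{TL}_{N_1+N_2+N_3}$.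
   Context: $\mathsf{TL}_N=\mathsf{TL}_N(m)$, $N\ge1$, is the unital $\mathbb C$-algebra generated by $e_1,\dots,e_{N-1}$ with $e_j^2=me_j$, $e_je_{j\pm1}e_j=e_j$, $e_je_k=e_ke_j$ ($|j-k|>1$). The standard embedding $\mathsf{TL}_N\to\mathsf{TL}_{N+k}$ is $e_j\mapsto e_j$. $\mathsf{TL}_{N_1}\otimes\mathsf{TL}_{N_2}$ is regarded as a subalgebra of $\mathsf{TL}_{N_1+N_2}$ via $e_j\otimes1\mapsto e_j$, $1\otimes e_k\mapsto e_{N_1+k}$. For $M_i$ a module over $\mathsf{TL}_{N_i}$, the fusion is $M_1\times_fM_2=\mathsf{TL}_{N_1+N_2}\otimes_{\mathsf{TL}_{N_1}\otimes\mathsf{TL}_{N_2}}(M_1\otimes M_2)$, a $\mathsf{TL}_{N_1+N_2}$-module; on morphisms $f\times_fg=\mathrm{id}\otimes f\otimes g$. *)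

theory Defs
  imports "HOL-Algebra.Algebra" "HOL-Algebra.Algebraic_Closure_Type"
begin

section \<open>Left modules over a not necessarily commutative ring\<close>

text \<open>
  The locale \<^locale>\<open>module\<close> insists on a commutative ring of scalars.  We keep its record type
  (whose fields \<^const>\<open>monoid.mult\<close> and \<^const>\<open>monoid.one\<close> play no role) and drop commutativity.
\<close>

locale left_module = R?: ring R + M?: abelian_group M
  for R :: "('r, 's) ring_scheme" (structure) and M :: "('r, 'x, 'u) module_scheme" (structure) +
  assumes smult_closed:
      "\<lbrakk>a \<in> carrier R; x \<in> carrier M\<rbrakk> \<Longrightarrow> a \<odot>\<^bsub>M\<^esub> x \<in> carrier M"
    and smult_l_distr:
      "\<lbrakk>a \<in> carrier R; b \<in> carrier R; x \<in> carrier M\<rbrakk> \<Longrightarrow>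
        (a \<oplus> b) \<odot>\<^bsub>M\<^esub> x = a \<odot>\<^bsub>M\<^esub> x \<oplus>\<^bsub>M\<^esub> b \<odot>\<^bsub>M\<^esub> x"
    and smult_r_distr:
      "\<lbrakk>a \<in> carrier R; x \<in> carrier M; y \<in> carrier M\<rbrakk> \<Longrightarrow>
        a \<odot>\<^bsub>M\<^esub> (x \<oplus>\<^bsub>M\<^esub> y) = a \<odot>\<^bsub>M\<^esub> x \<oplus>\<^bsub>M\<^esub> a \<odot>\<^bsub>M\<^esub> y"
    and smult_assoc:
      "\<lbrakk>a \<in> carrier R; b \<in> carrier R; x \<in> carrier M\<rbrakk> \<Longrightarrow>
        (a \<otimes> b) \<odot>\<^bsub>M\<^esub> x = a \<odot>\<^bsub>M\<^esub> (b \<odot>\<^bsub>M\<^esub> x)"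
    and smult_one:
      "x \<in> carrier M \<Longrightarrow> \<one> \<odot>\<^bsub>M\<^esub> x = x"

definition left_module_hom ::
    "('r, 's) ring_scheme \<Rightarrow> ('r, 'x, 'u) module_scheme \<Rightarrow> ('r, 'y, 'v) module_scheme \<Rightarrow> ('x \<Rightarrow> 'y) set"
  where "left_module_hom R M N =
    {f \<in> carrier M \<rightarrow> carrier N.
      (\<forall>x\<in>carrier M. \<forall>y\<in>carrier M. f (x \<oplus>\<^bsub>M\<^esub> y) = f x \<oplus>\<^bsub>N\<^esub> f y) \<and>
      (\<forall>r\<in>carrier R. \<forall>x\<in>carrier M. f (r \<odot>\<^bsub>M\<^esub> x) = r \<odot>\<^bsub>N\<^esub> f x)}"

definition left_module_iso ::
    "('r, 's) ring_scheme \<Rightarrow> ('r, 'x, 'u) module_scheme \<Rightarrow> ('r, 'y, 'v) module_scheme \<Rightarrow> ('x \<Rightarrow> 'y) set"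
  where "left_module_iso R M N =
    {f \<in> left_module_hom R M N. bij_betw f (carrier M) (carrier N)}"

definition with_smult :: "('x, 'e) ring_scheme \<Rightarrow> ('r \<Rightarrow> 'x \<Rightarrow> 'x) \<Rightarrow> ('r, 'x) module"
  where "with_smult G act =
    \<lparr>carrier = carrier G, monoid.mult = monoid.mult G, one = one G, ring.zero = ring.zero G, add = add G, module.smult = act\<rparr>"


section \<open>Tensor products over a not necessarily commutative ring\<close>

text \<open>
  For a right \<open>R\<close>-module \<open>V\<close>, with right action \<open>ract :: 'x \<Rightarrow> 'r \<Rightarrow> 'x\<close>, and a left \<open>R\<close>-module
  \<open>W\<close>, the abelian group \<open>V \<otimes>\<^sub>R W\<close> is the free abelian group on \<open>V \<times> W\<close> modulo the subgroup
  generated by the relations of biadditivity and \<open>R\<close>-balancedness.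
\<close>

definition tensor_relations ::
    "('r, 's) ring_scheme \<Rightarrow> ('x \<Rightarrow> 'r \<Rightarrow> 'x) \<Rightarrow> ('x, 'e) ring_scheme \<Rightarrow> ('r, 'y, 'u) module_scheme
      \<Rightarrow> (('x \<times> 'y) \<Rightarrow>\<^sub>0 int) set"
  where "tensor_relations R ract V W =
    {frag_of (x \<oplus>\<^bsub>V\<^esub> x', y) - frag_of (x, y) - frag_of (x', y) | x x' y.
        x \<in> carrier V \<and> x' \<in> carrier V \<and> y \<in> carrier W} \<union>
    {frag_of (x, y \<oplus>\<^bsub>W\<^esub> y') - frag_of (x, y) - frag_of (x, y') | x y y'.
        x \<in> carrier V \<and> y \<in> carrier W \<and> y' \<in> carrier W} \<union>
    {frag_of (ract x r, y) - frag_of (x, r \<odot>\<^bsub>W\<^esub> y) | x r y.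
        x \<in> carrier V \<and> r \<in> carrier R \<and> y \<in> carrier W}"

definition tensor_null ::
    "('r, 's) ring_scheme \<Rightarrow> ('x \<Rightarrow> 'r \<Rightarrow> 'x) \<Rightarrow> ('x, 'e) ring_scheme \<Rightarrow> ('r, 'y, 'u) module_scheme
      \<Rightarrow> (('x \<times> 'y) \<Rightarrow>\<^sub>0 int) set"
  where "tensor_null R ract V W =
    generate (free_Abelian_group (carrier V \<times> carrier W)) (tensor_relations R ract V W)"

definition tensor ::
    "('r, 's) ring_scheme \<Rightarrow> ('x \<Rightarrow> 'r \<Rightarrow> 'x) \<Rightarrow> ('x, 'e) ring_scheme \<Rightarrow> ('r, 'y, 'u) module_scheme
      \<Rightarrow> (('x \<times> 'y) \<Rightarrow>\<^sub>0 int) set ring"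
  where "tensor R ract V W =
    (let Q = free_Abelian_group (carrier V \<times> carrier W) Mod tensor_null R ract V W
     in \<lparr>carrier = carrier Q, monoid.mult = undefined, one = undefined, ring.zero = one Q, add = monoid.mult Q\<rparr>)"

definition pure_tensor ::
    "('r, 's) ring_scheme \<Rightarrow> ('x \<Rightarrow> 'r \<Rightarrow> 'x) \<Rightarrow> ('x, 'e) ring_scheme \<Rightarrow> ('r, 'y, 'u) module_scheme
      \<Rightarrow> 'x \<Rightarrow> 'y \<Rightarrow> (('x \<times> 'y) \<Rightarrow>\<^sub>0 int) set"
  where "pure_tensor R ract V W x y =
    tensor_null R ract V W #>\<^bsub>free_Abelian_group (carrier V \<times> carrier W)\<^esub> frag_of (x, y)"

text \<open>
  The additive map out of a tensor product with \<open>x \<otimes> y \<mapsto> \<beta> x y\<close>, for a biadditive balanced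
  \<open>\<beta>\<close> with values in the abelian group \<open>Z\<close>: evaluate a representative of the coset.
\<close>

definition tensor_lift ::
    "('z, 'e) ring_scheme \<Rightarrow> ('x \<Rightarrow> 'y \<Rightarrow> 'z) \<Rightarrow> (('x \<times> 'y) \<Rightarrow>\<^sub>0 int) set \<Rightarrow> 'z"
  where "tensor_lift Z \<beta> T =
    the_elem ((\<lambda>c. \<Oplus>\<^bsub>Z\<^esub>p\<in>Poly_Mapping.keys c.
                    add_pow Z (Poly_Mapping.lookup c p) (\<beta> (fst p) (snd p))) ` T)"


section \<open>Temperley--Lieb algebras\<close>

text \<open>
  Words in the letters \<open>0, 1, 2, \<dots>\<close>, written additively so that \<open>word \<Rightarrow>\<^sub>0 complex\<close>, with the
  convolution product of \<^theory>\<open>HOL-Library.Poly_Mapping\<close>, is the free associative algebra.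
\<close>

datatype word = Word (letters: "nat list")

instantiation word :: monoid_add
begin

definition zero_word :: word
  where "zero_word = Word []"

definition plus_word :: "word \<Rightarrow> word \<Rightarrow> word"
  where "plus_word u v = Word (letters u @ letters v)"

instance
  by standard (simp_all add: zero_word_def plus_word_def)

end

text \<open>The free algebra \<open>\<complex>\<langle>e\<^sub>1, \<dots>, e\<^bsub>N-1\<^esub>\<rangle>\<close>.\<close>

definition free_algebra :: "nat \<Rightarrow> (word \<Rightarrow>\<^sub>0 complex) ring"
  where "free_algebra N =
    \<lparr>carrier = {p. \<forall>w\<in>Poly_Mapping.keys p. set (letters w) \<subseteq> {1..<N}},
     monoid.mult = (*), one = 1, ring.zero = 0, add = (+)\<rparr>"

definition gen :: "nat \<Rightarrow> word \<Rightarrow>\<^sub>0 complex"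
  where "gen j = Poly_Mapping.single (Word [j]) 1"

definition const :: "complex \<Rightarrow> word \<Rightarrow>\<^sub>0 complex"
  where "const c = Poly_Mapping.single 0 c"

definition TL_relations :: "complex \<Rightarrow> nat \<Rightarrow> (word \<Rightarrow>\<^sub>0 complex) set"
  where "TL_relations m N =
    {gen j * gen j - const m * gen j | j. j \<in> {1..<N}} \<union>
    {gen j * gen k * gen j - gen j | j k.
        j \<in> {1..<N} \<and> k \<in> {1..<N} \<and> \<bar>int j - int k\<bar> = 1} \<union>
    {gen j * gen k - gen k * gen j | j k.
        j \<in> {1..<N} \<and> k \<in> {1..<N} \<and> \<bar>int j - int k\<bar> > 1}"

definition TL_ideal :: "complex \<Rightarrow> nat \<Rightarrow> (word \<Rightarrow>\<^sub>0 complex) set"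
  where "TL_ideal m N = genideal (free_algebra N) (TL_relations m N)"

type_synonym tl = "(word \<Rightarrow>\<^sub>0 complex) set"

definition TL :: "complex \<Rightarrow> nat \<Rightarrow> tl ring"
  where "TL m N = free_algebra N Quot TL_ideal m N"

definition TL_class :: "complex \<Rightarrow> nat \<Rightarrow> (word \<Rightarrow>\<^sub>0 complex) \<Rightarrow> tl"
  where "TL_class m N p = TL_ideal m N +>\<^bsub>free_algebra N\<^esub> p"

definition shift_letters :: "nat \<Rightarrow> (word \<Rightarrow>\<^sub>0 complex) \<Rightarrow> (word \<Rightarrow>\<^sub>0 complex)"
  where "shift_letters s p =
    (\<Sum>w\<in>Poly_Mapping.keys p.
        Poly_Mapping.single (Word (map ((+) s) (letters w))) (Poly_Mapping.lookup p w))"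

text \<open>
  The algebra homomorphism \<open>TL\<^sub>N \<rightarrow> TL\<^sub>K\<close> with \<open>e\<^sub>j \<mapsto> e\<^bsub>s+j\<^esub>\<close>, for \<open>s + N \<le> K\<close>.  The case
  \<open>s = 0\<close> is the standard embedding.
\<close>

definition TL_shift :: "complex \<Rightarrow> nat \<Rightarrow> nat \<Rightarrow> nat \<Rightarrow> tl \<Rightarrow> tl"
  where "TL_shift m s N K a = the_elem ((\<lambda>p. TL_class m K (shift_letters s p)) ` a)"

abbreviation TL_embed :: "complex \<Rightarrow> nat \<Rightarrow> nat \<Rightarrow> tl \<Rightarrow> tl"
  where "TL_embed m N K \<equiv> TL_shift m 0 N K"


section \<open>Tensor products over the complex numbers\<close>

text \<open>
  A left module over the ring \<open>TL\<^sub>N\<close> is a complex vector space via the scalars in \<open>TL\<^sub>N\<close>.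
\<close>

definition cscale :: "complex \<Rightarrow> nat \<Rightarrow> (tl, 'x) module \<Rightarrow> complex \<Rightarrow> 'x \<Rightarrow> 'x"
  where "cscale m N M c x = TL_class m N (const c) \<odot>\<^bsub>M\<^esub> x"

definition ctensor ::
    "complex \<Rightarrow> nat \<Rightarrow> nat \<Rightarrow> (tl, 'x) module \<Rightarrow> (tl, 'y) module \<Rightarrow> (('x \<times> 'y) \<Rightarrow>\<^sub>0 int) set ring"
  where "ctensor m N1 N2 M1 M2 =
    tensor ring_of_type_algebra (\<lambda>x c. cscale m N1 M1 c x) M1 (with_smult M2 (cscale m N2 M2))"

definition cpure ::
    "complex \<Rightarrow> nat \<Rightarrow> nat \<Rightarrow> (tl, 'x) module \<Rightarrow> (tl, 'y) module
      \<Rightarrow> 'x \<Rightarrow> 'y \<Rightarrow> (('x \<times> 'y) \<Rightarrow>\<^sub>0 int) set"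
  where "cpure m N1 N2 M1 M2 =
    pure_tensor ring_of_type_algebra (\<lambda>x c. cscale m N1 M1 c x) M1 (with_smult M2 (cscale m N2 M2))"

text \<open>\<open>(a \<otimes> b) \<cdot> (x \<otimes> y) = (a \<cdot> x) \<otimes> (b \<cdot> y)\<close>\<close>

definition outer_act ::
    "complex \<Rightarrow> nat \<Rightarrow> nat \<Rightarrow> (tl, 'x) module \<Rightarrow> (tl, 'y) module
      \<Rightarrow> ((tl \<times> tl) \<Rightarrow>\<^sub>0 int) set \<Rightarrow> (('x \<times> 'y) \<Rightarrow>\<^sub>0 int) set \<Rightarrow> (('x \<times> 'y) \<Rightarrow>\<^sub>0 int) set"
  where "outer_act m N1 N2 M1 M2 t u =
    tensor_lift (ctensor m N1 N2 M1 M2)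
      (\<lambda>a b. tensor_lift (ctensor m N1 N2 M1 M2)
          (\<lambda>x y. cpure m N1 N2 M1 M2 (a \<odot>\<^bsub>M1\<^esub> x) (b \<odot>\<^bsub>M2\<^esub> y)) u) t"

definition TL_regular :: "complex \<Rightarrow> nat \<Rightarrow> (tl, tl) module"
  where "TL_regular m N = with_smult (TL m N) (monoid.mult (TL m N))"

text \<open>The algebra \<open>TL\<^bsub>N1\<^esub> \<otimes> TL\<^bsub>N2\<^esub>\<close> and its homomorphism into \<open>TL\<^bsub>N1+N2\<^esub>\<close>.\<close>

definition TL_tensor :: "complex \<Rightarrow> nat \<Rightarrow> nat \<Rightarrow> ((tl \<times> tl) \<Rightarrow>\<^sub>0 int) set ring"
  where "TL_tensor m N1 N2 =
    (let A1 = TL_regular m N1; A2 = TL_regular m N2; T = ctensor m N1 N2 A1 A2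
     in \<lparr>carrier = carrier T,
         monoid.mult = outer_act m N1 N2 A1 A2,
         one = cpure m N1 N2 A1 A2 \<one>\<^bsub>TL m N1\<^esub> \<one>\<^bsub>TL m N2\<^esub>,
         ring.zero = ring.zero T, add = add T\<rparr>)"

definition TL_incl :: "complex \<Rightarrow> nat \<Rightarrow> nat \<Rightarrow> ((tl \<times> tl) \<Rightarrow>\<^sub>0 int) set \<Rightarrow> tl"
  where "TL_incl m N1 N2 =
    tensor_lift (TL m (N1 + N2))
      (\<lambda>a b. TL_shift m 0 N1 (N1 + N2) a \<otimes>\<^bsub>TL m (N1 + N2)\<^esub> TL_shift m N1 N2 (N1 + N2) b)"

definition outer_tensor ::
    "complex \<Rightarrow> nat \<Rightarrow> nat \<Rightarrow> (tl, 'x) module \<Rightarrow> (tl, 'y) module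
      \<Rightarrow> (((tl \<times> tl) \<Rightarrow>\<^sub>0 int) set, (('x \<times> 'y) \<Rightarrow>\<^sub>0 int) set) module"
  where "outer_tensor m N1 N2 M1 M2 =
    with_smult (ctensor m N1 N2 M1 M2) (outer_act m N1 N2 M1 M2)"


section \<open>Fusion\<close>

type_synonym ('x, 'y) fusion_elem = "((tl \<times> (('x \<times> 'y) \<Rightarrow>\<^sub>0 int) set) \<Rightarrow>\<^sub>0 int) set"

definition fusion_group ::
    "complex \<Rightarrow> nat \<Rightarrow> nat \<Rightarrow> (tl, 'x) module \<Rightarrow> (tl, 'y) module \<Rightarrow> ('x, 'y) fusion_elem ring"
  where "fusion_group m N1 N2 M1 M2 =
    tensor (TL_tensor m N1 N2) (\<lambda>a t. a \<otimes>\<^bsub>TL m (N1 + N2)\<^esub> TL_incl m N1 N2 t)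
      (TL m (N1 + N2)) (outer_tensor m N1 N2 M1 M2)"

text \<open>The element \<open>a \<otimes> u\<close> for \<open>a\<close> in \<open>TL\<^bsub>N1+N2\<^esub>\<close> and \<open>u\<close> in \<open>M1 \<otimes> M2\<close>.\<close>

definition fusion_pure ::
    "complex \<Rightarrow> nat \<Rightarrow> nat \<Rightarrow> (tl, 'x) module \<Rightarrow> (tl, 'y) module
      \<Rightarrow> tl \<Rightarrow> (('x \<times> 'y) \<Rightarrow>\<^sub>0 int) set \<Rightarrow> ('x, 'y) fusion_elem"
  where "fusion_pure m N1 N2 M1 M2 =
    pure_tensor (TL_tensor m N1 N2) (\<lambda>a t. a \<otimes>\<^bsub>TL m (N1 + N2)\<^esub> TL_incl m N1 N2 t)
      (TL m (N1 + N2)) (outer_tensor m N1 N2 M1 M2)"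

definition fusion ::
    "complex \<Rightarrow> nat \<Rightarrow> nat \<Rightarrow> (tl, 'x) module \<Rightarrow> (tl, 'y) module
      \<Rightarrow> (tl, ('x, 'y) fusion_elem) module"
  where "fusion m N1 N2 M1 M2 =
    with_smult (fusion_group m N1 N2 M1 M2)
      (\<lambda>s. tensor_lift (fusion_group m N1 N2 M1 M2)
          (\<lambda>a u. fusion_pure m N1 N2 M1 M2 (s \<otimes>\<^bsub>TL m (N1 + N2)\<^esub> a) u))"

text \<open>The element \<open>a \<otimes> (x \<otimes> y)\<close>.\<close>

definition fusion_tensor ::
    "complex \<Rightarrow> nat \<Rightarrow> nat \<Rightarrow> (tl, 'x) module \<Rightarrow> (tl, 'y) module
      \<Rightarrow> tl \<Rightarrow> 'x \<Rightarrow> 'y \<Rightarrow> ('x, 'y) fusion_elem"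
  where "fusion_tensor m N1 N2 M1 M2 a x y =
    fusion_pure m N1 N2 M1 M2 a (cpure m N1 N2 M1 M2 x y)"

text \<open>\<open>f \<times>\<^sub>f g = id \<otimes> f \<otimes> g\<close> for \<open>f : M1 \<rightarrow> M1'\<close> and \<open>g : M2 \<rightarrow> M2'\<close>; only the targets
  are needed as parameters.\<close>

definition fusion_map ::
    "complex \<Rightarrow> nat \<Rightarrow> nat \<Rightarrow> (tl, 'x2) module \<Rightarrow> (tl, 'y2) module
      \<Rightarrow> ('x1 \<Rightarrow> 'x2) \<Rightarrow> ('y1 \<Rightarrow> 'y2) \<Rightarrow> ('x1, 'y1) fusion_elem \<Rightarrow> ('x2, 'y2) fusion_elem"
  where "fusion_map m N1 N2 M1' M2' f g =
    tensor_lift (fusion m N1 N2 M1' M2')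
      (\<lambda>a u. fusion_pure m N1 N2 M1' M2' a
          (tensor_lift (ctensor m N1 N2 M1' M2') (\<lambda>x y. cpure m N1 N2 M1' M2' (f x) (g y)) u))"

text \<open>
  The associator, obtained by extending
  \<open>a \<otimes> ((b \<otimes> (x \<otimes> y)) \<otimes> z) \<mapsto> ab \<otimes> (x \<otimes> (1 \<otimes> (y \<otimes> z)))\<close> additively through the four tensor
  products from which the source is built: \<open>t\<close>, \<open>w\<close>, \<open>u\<close> range over \<open>(M1 \<times>\<^sub>f M2) \<otimes> M3\<close>,
  \<open>M1 \<times>\<^sub>f M2\<close> and \<open>M1 \<otimes> M2\<close>.
\<close>

definition associator ::
    "complex \<Rightarrow> nat \<Rightarrow> nat \<Rightarrow> nat \<Rightarrow> (tl, 'x) module \<Rightarrow> (tl, 'y) module \<Rightarrow> (tl, 'z) module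
      \<Rightarrow> (('x, 'y) fusion_elem, 'z) fusion_elem \<Rightarrow> ('x, ('y, 'z) fusion_elem) fusion_elem"
  where "associator m N1 N2 N3 M1 M2 M3 =
    (let F23 = fusion m N2 N3 M2 M3;
         Z = fusion m N1 (N2 + N3) M1 F23;
         A = TL m (N1 + N2 + N3)
     in tensor_lift Z (\<lambda>a t. tensor_lift Z (\<lambda>w z. tensor_lift Z (\<lambda>b u. tensor_lift Z (\<lambda>x y.
          fusion_tensor m N1 (N2 + N3) M1 F23 (a \<otimes>\<^bsub>A\<^esub> TL_embed m (N1 + N2) (N1 + N2 + N3) b)
            x (fusion_tensor m N2 N3 M2 M3 \<one>\<^bsub>TL m (N2 + N3)\<^esub> y z)) u) w) t))"

end

theory Submission
  imports Defs
begin

text \<open>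
  Both iterated fusions represent the same functor.  Everything rests on one universal property:
  additive maps from \<open>M\<^sub>1 \<times>\<^sub>f M\<^sub>2\<close> to an abelian group \<open>Z\<close> correspond to maps \<open>\<beta> a x y\<close> that are
  additive in each of their three arguments and let \<open>TL\<^bsub>N1\<^esub>\<close> and \<open>TL\<^bsub>N2\<^esub>\<close> pass from the coefficient
  \<open>a\<close> to \<open>x\<close> and to \<open>y\<close> (predicate \<open>fusion_balanced\<close>, lemmas \<open>fusion_lift\<close> and \<open>fusion_ext\<close>).
  In this form the intermediate tensor products, the one over \<open>\<complex>\<close> and the algebra
  \<open>TL\<^bsub>N1\<^esub> \<otimes> TL\<^bsub>N2\<^esub>\<close>, have disappeared: an element \<open>t\<close> of that algebra is a sum of pure tensors \<open>b \<otimes> c\<close>,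
  so balancedness over it amounts to balancedness over the two factors, and balancedness over
  \<open>\<complex>\<close> is the case of scalars, which have the same image in \<open>TL\<^bsub>N1+N2\<^esub>\<close> from either side.

  Given this, \<open>a \<otimes> (b \<otimes> x \<otimes> y) \<otimes> z \<mapsto> ab \<otimes> (x \<otimes> (1 \<otimes> y \<otimes> z))\<close> is well defined for three reasons.
  An element of \<open>TL\<^bsub>N1\<^esub>\<close> moves to \<open>x\<close> directly.  An element of \<open>TL\<^bsub>N2\<^esub>\<close> has the same image in
  \<open>TL\<^bsub>N1+N2+N3\<^esub>\<close> through \<open>TL\<^bsub>N1+N2\<^esub>\<close> and through \<open>TL\<^bsub>N2+N3\<^esub>\<close>; hence it can be moved into the inner
  fusion, past the unit, and on to \<open>y\<close>.  An element of \<open>TL\<^bsub>N3\<^esub>\<close>, shifted by \<open>N1 + N2\<close>, commutes with the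
  image of \<open>b\<close>, because generators whose indices differ by more than one commute; after that it reaches
  \<open>z\<close> in the same way.  The relations of the Temperley--Lieb algebra enter only through this last
  point, \<open>TL_shift_commute\<close>, and through the fact that shifting indices respects them, so that
  the shifts are algebra homomorphisms.

  The inverse is built symmetrically, \<open>a \<otimes> (x \<otimes> (d \<otimes> y \<otimes> z)) \<mapsto> ad \<otimes> ((1 \<otimes> x \<otimes> y) \<otimes> z)\<close>.  That the two
  maps are mutually inverse, linearity of the associator over the algebra, and naturality are identities of
  additive maps, so they only have to be compared on the elements \<open>a \<otimes> (b \<otimes> x \<otimes> y) \<otimes> z\<close> and
  \<open>a \<otimes> (x \<otimes> (d \<otimes> y \<otimes> z))\<close>, where they follow from the formulas above.
\<close>

section \<open>Additive maps\<close>

text \<open>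
  The morphisms of abelian groups, stated for the ring records that carry tensor products and fusions.
\<close>

definition additive_map :: "('a, 'm) ring_scheme \<Rightarrow> ('b, 'n) ring_scheme \<Rightarrow> ('a \<Rightarrow> 'b) \<Rightarrow> bool"
  where "additive_map G H f \<longleftrightarrow> f \<in> carrier G \<rightarrow> carrier H \<and>
    (\<forall>x\<in>carrier G. \<forall>y\<in>carrier G. f (x \<oplus>\<^bsub>G\<^esub> y) = f x \<oplus>\<^bsub>H\<^esub> f y)"

lemma additiveI:
  assumes "\<And>x. x \<in> carrier G \<Longrightarrow> f x \<in> carrier H"
    and "\<And>x y. \<lbrakk>x \<in> carrier G; y \<in> carrier G\<rbrakk> \<Longrightarrow> f (x \<oplus>\<^bsub>G\<^esub> y) = f x \<oplus>\<^bsub>H\<^esub> f y"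
  shows "additive_map G H f"
  using assms unfolding additive_map_def by auto

lemma additive_closed: "additive_map G H f \<Longrightarrow> x \<in> carrier G \<Longrightarrow> f x \<in> carrier H"
  unfolding additive_map_def by auto

lemma additive_add:
  "additive_map G H f \<Longrightarrow> x \<in> carrier G \<Longrightarrow> y \<in> carrier G \<Longrightarrow> f (x \<oplus>\<^bsub>G\<^esub> y) = f x \<oplus>\<^bsub>H\<^esub> f y"
  unfolding additive_map_def by auto

lemma additive_compose: "additive_map G H f \<Longrightarrow> additive_map H K g \<Longrightarrow> additive_map G K (\<lambda>x. g (f x))"
  unfolding additive_map_def by (auto simp: Pi_iff)

lemma additive_id: "additive_map G G (\<lambda>x. x)"
  unfolding additive_map_def by auto

lemma additive_zero:
  assumes "abelian_group G" "abelian_group H" "additive_map G H f"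
  shows "f \<zero>\<^bsub>G\<^esub> = \<zero>\<^bsub>H\<^esub>"
proof -
  interpret G: abelian_group G by fact
  interpret H: abelian_group H by fact
  have f0: "f \<zero>\<^bsub>G\<^esub> \<in> carrier H"
    using assms(3) by (simp add: additive_closed)
  have "f \<zero>\<^bsub>G\<^esub> \<oplus>\<^bsub>H\<^esub> f \<zero>\<^bsub>G\<^esub> = f \<zero>\<^bsub>G\<^esub>"
    using additive_add[OF assms(3), of "\<zero>\<^bsub>G\<^esub>" "\<zero>\<^bsub>G\<^esub>"] by simp
  then show ?thesis
    using f0 by (metis H.add.l_cancel_one)
qed

lemma additive_add_functions:
  assumes "abelian_group H" "additive_map G H f" "additive_map G H g"
  shows "additive_map G H (\<lambda>x. f x \<oplus>\<^bsub>H\<^esub> g x)"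
proof -
  interpret H: abelian_group H by fact
  show ?thesis
    using assms(2,3) by (auto simp: additive_map_def Pi_iff H.a_ac)
qed

lemma additive_neg:
  assumes "abelian_group G" "abelian_group H" "additive_map G H f" "x \<in> carrier G"
  shows "f (\<ominus>\<^bsub>G\<^esub> x) = \<ominus>\<^bsub>H\<^esub> f x"
proof -
  interpret G: abelian_group G by fact
  interpret H: abelian_group H by fact
  have "f (\<ominus>\<^bsub>G\<^esub> x) \<oplus>\<^bsub>H\<^esub> f x = \<zero>\<^bsub>H\<^esub>"
    using additive_add[OF assms(3), of "\<ominus>\<^bsub>G\<^esub> x" x] assms additive_zero[OF assms(1-3)] by (simp add: G.l_neg)
  then show ?thesis
    using assms by (simp add: H.minus_equality additive_closed)
qed

section \<open>Tensor products and their universal property\<close>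

definition balanced_map ::
    "('r, 's) ring_scheme \<Rightarrow> ('x \<Rightarrow> 'r \<Rightarrow> 'x) \<Rightarrow> ('x, 'e) ring_scheme \<Rightarrow> ('r, 'y, 'u) module_scheme
      \<Rightarrow> ('z, 'f) ring_scheme \<Rightarrow> ('x \<Rightarrow> 'y \<Rightarrow> 'z) \<Rightarrow> bool"
  where "balanced_map R ract V W Z \<beta> \<longleftrightarrow>
    (\<forall>x\<in>carrier V. additive_map W Z (\<beta> x)) \<and>
    (\<forall>y\<in>carrier W. additive_map V Z (\<lambda>x. \<beta> x y)) \<and>
    (\<forall>x\<in>carrier V. \<forall>r\<in>carrier R. \<forall>y\<in>carrier W. \<beta> (ract x r) y = \<beta> x (r \<odot>\<^bsub>W\<^esub> y))"

lemma balanced_mapI: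
  assumes "\<And>x. x \<in> carrier V \<Longrightarrow> additive_map W Z (\<beta> x)"
    and "\<And>y. y \<in> carrier W \<Longrightarrow> additive_map V Z (\<lambda>x. \<beta> x y)"
    and "\<And>x r y. \<lbrakk>x \<in> carrier V; r \<in> carrier R; y \<in> carrier W\<rbrakk> \<Longrightarrow> \<beta> (ract x r) y = \<beta> x (r \<odot>\<^bsub>W\<^esub> y)"
  shows "balanced_map R ract V W Z \<beta>"
  using assms unfolding balanced_map_def by auto

text \<open>
  The additive extension of \<open>f\<close> to the free abelian group, written with the sum over the support that
  \<^const>\<open>tensor_lift\<close> uses.  It is additive since the support can be enlarged to a common
  finite set at no cost.
\<close>

lemma (in comm_group) frag_evaluation_hom:
  assumes f: "f \<in> S \<rightarrow> carrier G"
  shows "(\<lambda>c. finprod G (\<lambda>p. f p [^] Poly_Mapping.lookup c p) (Poly_Mapping.keys c))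
           \<in> hom (free_Abelian_group S) G"
proof -
  let ?e = "\<lambda>c A. finprod G (\<lambda>p. f p [^] Poly_Mapping.lookup c p) A"
  have ext: "?e c (Poly_Mapping.keys c) = ?e c A"
    if "Poly_Mapping.keys c \<subseteq> A" "finite A" "A \<subseteq> S" for c :: "_ \<Rightarrow>\<^sub>0 int" and A
  proof (rule finprod_mono_neutral_cong_left)
    have f': "f p \<in> carrier G" if "p \<in> A" for p using f \<open>A \<subseteq> S\<close> that by blast
    then show "(\<lambda>p. f p [^] Poly_Mapping.lookup c p) \<in> A \<rightarrow> carrier G" by auto
    show "f p [^] Poly_Mapping.lookup c p = \<one>" if "p \<in> A - Poly_Mapping.keys c" for p
      using f'[of p] that by (simp add: in_keys_iff)
  qed (use that in auto)
  show ?thesis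
  proof (rule homI)
    fix c assume "c \<in> carrier (free_Abelian_group S)"
    then show "?e c (Poly_Mapping.keys c) \<in> carrier G"
      using f by (auto intro!: finprod_closed)
  next
    fix c d assume "c \<in> carrier (free_Abelian_group S)" "d \<in> carrier (free_Abelian_group S)"
    then have c: "Poly_Mapping.keys c \<subseteq> S" and d: "Poly_Mapping.keys d \<subseteq> S" by auto
    let ?A = "Poly_Mapping.keys c \<union> Poly_Mapping.keys d"
    have A: "finite ?A" "?A \<subseteq> S" using c d by auto
    have "?e (c + d) (Poly_Mapping.keys (c + d)) = ?e (c + d) ?A"
      by (rule ext[OF keys_add A])
    also have "\<dots> = finprod G (\<lambda>p. f p [^] Poly_Mapping.lookup c p \<otimes> f p [^] Poly_Mapping.lookup d p) ?A"
    proof (rule finprod_cong')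
      have f': "f p \<in> carrier G" if "p \<in> ?A" for p using f A that by blast
      then show "(\<lambda>p. f p [^] Poly_Mapping.lookup c p \<otimes> f p [^] Poly_Mapping.lookup d p) \<in> ?A \<rightarrow> carrier G" by auto
      show "f p [^] Poly_Mapping.lookup (c + d) p =
          f p [^] Poly_Mapping.lookup c p \<otimes> f p [^] Poly_Mapping.lookup d p" if "p \<in> ?A" for p
        using f'[OF that] by (simp add: lookup_add int_pow_mult)
    qed simp
    also have "\<dots> = ?e c ?A \<otimes> ?e d ?A"
      using f A by (intro finprod_multf) auto
    also have "\<dots> = ?e c (Poly_Mapping.keys c) \<otimes> ?e d (Poly_Mapping.keys d)"
      using A by (simp add: ext[of c ?A] ext[of d ?A])
    finally show "?e (c \<otimes>\<^bsub>free_Abelian_group S\<^esub> d) (Poly_Mapping.keys (c \<otimes>\<^bsub>free_Abelian_group S\<^esub> d)) =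
        ?e c (Poly_Mapping.keys c) \<otimes> ?e d (Poly_Mapping.keys d)" by simp
  qed
qed

text \<open>
  Closure of both carriers under the action is what places the tensor relations inside the free
  abelian group on \<open>carrier V \<times> carrier W\<close>.
\<close>

locale tensor_factors = V: abelian_group V + W: abelian_group W
  for R :: "('r, 's) ring_scheme" and ract :: "'x \<Rightarrow> 'r \<Rightarrow> 'x"
    and V :: "('x, 'e) ring_scheme" and W :: "('r, 'y, 'u) module_scheme" +
  assumes ract_closed: "\<lbrakk>x \<in> carrier V; r \<in> carrier R\<rbrakk> \<Longrightarrow> ract x r \<in> carrier V"
    and lact_closed: "\<lbrakk>r \<in> carrier R; y \<in> carrier W\<rbrakk> \<Longrightarrow> r \<odot>\<^bsub>W\<^esub> y \<in> carrier W"
begin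

abbreviation "F \<equiv> free_Abelian_group (carrier V \<times> carrier W)"
abbreviation "N \<equiv> tensor_null R ract V W"
abbreviation "T \<equiv> tensor R ract V W"
abbreviation "pt \<equiv> pure_tensor R ract V W"

lemma relations_subset: "tensor_relations R ract V W \<subseteq> carrier F"
proof
  fix c assume "c \<in> tensor_relations R ract V W"
  then show "c \<in> carrier F"
    unfolding tensor_relations_def
    by (auto simp: keys_frag_of ract_closed lact_closed dest!: subsetD[OF keys_diff])
qed

lemma null_normal: "N \<lhd> F"
proof -
  interpret F: comm_group F by (rule abelian_free_Abelian_group)
  have "subgroup N F"
    unfolding tensor_null_def by (rule F.generate_is_subgroup[OF relations_subset])
  then show ?thesis by (rule F.subgroup_imp_normal)
qed

lemma add_monoid_tensor: "add_monoid T = F Mod N"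
  by (simp add: tensor_def Let_def FactGroup_def)

lemma tensor_abelian_group: "abelian_group T"
proof -
  interpret F: comm_group F by (rule abelian_free_Abelian_group)
  have "comm_group (add_monoid T)"
    unfolding add_monoid_tensor
    by (rule F.abelian_FactGroup) (rule normal_imp_subgroup[OF null_normal])
  then show ?thesis
    by (rule comm_group_abelian_groupI)
qed

lemma carrier_tensor: "carrier T = (\<lambda>c. N #>\<^bsub>F\<^esub> c) ` carrier F"
  by (simp add: tensor_def Let_def carrier_FactGroup)

lemma add_cosets:
  assumes "c \<in> carrier F" "d \<in> carrier F"
  shows "(N #>\<^bsub>F\<^esub> c) \<oplus>\<^bsub>T\<^esub> (N #>\<^bsub>F\<^esub> d) = N #>\<^bsub>F\<^esub> (c + d)"
proof -
  interpret N: normal N F by (rule null_normal)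
  show ?thesis
    using N.rcos_sum[OF assms] by (simp add: tensor_def Let_def)
qed

lemma pure_closed: "\<lbrakk>x \<in> carrier V; y \<in> carrier W\<rbrakk> \<Longrightarrow> pt x y \<in> carrier T"
  unfolding carrier_tensor pure_tensor_def by auto

lemma coset_eqI:
  assumes "c \<in> carrier F" "d \<in> carrier F" "c - d \<in> N"
  shows "N #>\<^bsub>F\<^esub> c = N #>\<^bsub>F\<^esub> d"
proof -
  interpret N: normal N F by (rule null_normal)
  have "c = (c - d) \<otimes>\<^bsub>F\<^esub> d" by simp
  then have "c \<in> N #>\<^bsub>F\<^esub> d"
    using assms(3) unfolding r_coset_def by blast
  then show ?thesis
    using N.repr_independence[OF _ assms(2)] N.is_subgroup by metis
qed

lemma relation_in_null: "c \<in> tensor_relations R ract V W \<Longrightarrow> c \<in> N"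
  unfolding tensor_null_def by (rule generate.incl)

lemma pure_add_left:
  assumes "x \<in> carrier V" "x' \<in> carrier V" "y \<in> carrier W"
  shows "pt (x \<oplus>\<^bsub>V\<^esub> x') y = pt x y \<oplus>\<^bsub>T\<^esub> pt x' y"
proof -
  have "frag_of (x \<oplus>\<^bsub>V\<^esub> x', y) - (frag_of (x, y) + frag_of (x', y)) \<in> N"
    by (rule relation_in_null) (use assms in \<open>auto simp: tensor_relations_def diff_diff_eq[symmetric]\<close>)
  then have "N #>\<^bsub>F\<^esub> frag_of (x \<oplus>\<^bsub>V\<^esub> x', y) = N #>\<^bsub>F\<^esub> (frag_of (x, y) + frag_of (x', y))"
    using assms by (intro coset_eqI) (auto dest!: subsetD[OF keys_add] simp: keys_frag_of)
  then show ?thesis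
    using assms add_cosets[of "frag_of (x, y)" "frag_of (x', y)"] by (simp add: pure_tensor_def)
qed

lemma pure_add_right:
  assumes "x \<in> carrier V" "y \<in> carrier W" "y' \<in> carrier W"
  shows "pt x (y \<oplus>\<^bsub>W\<^esub> y') = pt x y \<oplus>\<^bsub>T\<^esub> pt x y'"
proof -
  have "frag_of (x, y \<oplus>\<^bsub>W\<^esub> y') - (frag_of (x, y) + frag_of (x, y')) \<in> N"
    by (rule relation_in_null) (use assms in \<open>auto simp: tensor_relations_def diff_diff_eq[symmetric]\<close>)
  then have "N #>\<^bsub>F\<^esub> frag_of (x, y \<oplus>\<^bsub>W\<^esub> y') = N #>\<^bsub>F\<^esub> (frag_of (x, y) + frag_of (x, y'))"
    using assms by (intro coset_eqI) (auto dest!: subsetD[OF keys_add] simp: keys_frag_of)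
  then show ?thesis
    using assms add_cosets[of "frag_of (x, y)" "frag_of (x, y')"] by (simp add: pure_tensor_def)
qed

lemma pure_balanced:
  assumes "x \<in> carrier V" "r \<in> carrier R" "y \<in> carrier W"
  shows "pt (ract x r) y = pt x (r \<odot>\<^bsub>W\<^esub> y)"
proof -
  have "frag_of (ract x r, y) - frag_of (x, r \<odot>\<^bsub>W\<^esub> y) \<in> N"
    by (rule relation_in_null) (use assms in \<open>auto simp: tensor_relations_def\<close>)
  then show ?thesis
    unfolding pure_tensor_def
    using assms by (intro coset_eqI) (auto simp: ract_closed lact_closed)
qed

lemma pure_balanced_map: "balanced_map R ract V W T pt"
  by (intro balanced_mapI additiveI pure_closed pure_add_left pure_add_right pure_balanced)

text \<open>
  Every element is a finite sum of pure tensors: integer coefficients are absorbed into the first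
  factor, since \<open>-(x \<otimes> y) = (-x) \<otimes> y\<close> and \<open>0 = 0 \<otimes> 0\<close>.
\<close>

lemma tensor_induct [consumes 1, case_names pure add]:
  assumes t: "t \<in> carrier T"
    and pure: "\<And>x y. \<lbrakk>x \<in> carrier V; y \<in> carrier W\<rbrakk> \<Longrightarrow> P (pt x y)"
    and add: "\<And>t u. \<lbrakk>t \<in> carrier T; u \<in> carrier T; P t; P u\<rbrakk> \<Longrightarrow> P (t \<oplus>\<^bsub>T\<^esub> u)"
  shows "P t"
proof -
  interpret T: abelian_group T by (rule tensor_abelian_group)
  interpret N: normal N F by (rule null_normal)
  obtain c where c: "Poly_Mapping.keys c \<subseteq> carrier V \<times> carrier W" and tc: "t = N #>\<^bsub>F\<^esub> c"
    using t by (auto simp: carrier_tensor)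
  have zero_coset: "N #>\<^bsub>F\<^esub> 0 = \<zero>\<^bsub>T\<^esub>"
    using N.coset_mult_one[OF N.subset] by (simp add: tensor_def Let_def FactGroup_def)
  have neg: "\<ominus>\<^bsub>T\<^esub> pt x y = pt (\<ominus>\<^bsub>V\<^esub> x) y" if xy: "x \<in> carrier V" "y \<in> carrier W" for x y
    using additive_neg[OF V.abelian_group_axioms tensor_abelian_group _ xy(1), of "\<lambda>x. pt x y"]
      pure_balanced_map xy by (simp add: balanced_map_def)
  \<comment> \<open>Negatives have to be carried along, since the free abelian group is generated under subtraction.\<close>
  have "P (N #>\<^bsub>F\<^esub> c) \<and> P (\<ominus>\<^bsub>T\<^esub> (N #>\<^bsub>F\<^esub> c))"
    using c
  proof (induction c rule: free_Abelian_group_induct[consumes 1, case_names zero diff of])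
    case zero
    have "pt \<zero>\<^bsub>V\<^esub> \<zero>\<^bsub>W\<^esub> = \<zero>\<^bsub>T\<^esub>"
      using additive_zero[OF V.abelian_group_axioms tensor_abelian_group, of "\<lambda>x. pt x \<zero>\<^bsub>W\<^esub>"]
        pure_balanced_map by (simp add: balanced_map_def)
    moreover have neg_zero: "\<ominus>\<^bsub>T\<^esub> \<zero>\<^bsub>T\<^esub> = \<zero>\<^bsub>T\<^esub>"
      by (rule T.minus_equality) auto
    ultimately show ?case
      using pure[of "\<zero>\<^bsub>V\<^esub>" "\<zero>\<^bsub>W\<^esub>"] by (simp add: zero_coset neg_zero)
  next
    case (diff c d)
    let ?c = "N #>\<^bsub>F\<^esub> c" and ?d = "N #>\<^bsub>F\<^esub> d"
    have cl: "?c \<in> carrier T" "?d \<in> carrier T"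
      using diff by (auto simp: carrier_tensor)
    have cd: "N #>\<^bsub>F\<^esub> (c - d) \<in> carrier T"
      using diff by (auto simp: carrier_tensor intro!: imageI order.trans[OF keys_diff])
    have "(N #>\<^bsub>F\<^esub> (c - d)) \<oplus>\<^bsub>T\<^esub> ?d = ?c"
      using diff order.trans[OF keys_diff, of c d "carrier V \<times> carrier W"] by (subst add_cosets) auto
    then have "N #>\<^bsub>F\<^esub> (c - d) = ?c \<oplus>\<^bsub>T\<^esub> (\<ominus>\<^bsub>T\<^esub> ?d)"
      using cl cd by (metis T.a_inv_closed T.add.m_assoc T.r_neg T.r_zero)
    then show ?case
      using diff cl by (auto simp: T.minus_add intro!: add)
  next
    case (of p)
    then show ?case
      by (cases p) (auto simp: pure_tensor_def[symmetric] neg intro!: pure)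
  qed
  then show ?thesis by (simp add: tc)
qed

lemma tensor_additive_ext:
  assumes f: "additive_map T Z f" and g: "additive_map T Z g"
    and eq: "\<And>x y. \<lbrakk>x \<in> carrier V; y \<in> carrier W\<rbrakk> \<Longrightarrow> f (pt x y) = g (pt x y)"
    and t: "t \<in> carrier T"
  shows "f t = g t"
  using t by (induction rule: tensor_induct) (simp_all add: eq additive_add[OF f] additive_add[OF g])

lemma balanced_map_cong:
  assumes "\<And>x y. \<lbrakk>x \<in> carrier V; y \<in> carrier W\<rbrakk> \<Longrightarrow> \<gamma> x y = \<beta> x y"
    and "balanced_map R ract V W Z \<beta>"
  shows "balanced_map R ract V W Z \<gamma>"
  using assms by (simp add: balanced_map_def additive_map_def Pi_iff ract_closed lact_closed)

text \<open>
  The universal property.  Evaluation is a homomorphism on the free abelian group and kills the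
  relations; hence it is constant on each coset, and \<^const>\<open>the_elem\<close> picks that value.
\<close>

lemma tensor_lift_properties:
  assumes Z: "abelian_group Z" and \<beta>: "balanced_map R ract V W Z \<beta>"
  shows tensor_lift_additive: "additive_map T Z (tensor_lift Z \<beta>)"
    and tensor_lift_pure:
      "\<And>x y. \<lbrakk>x \<in> carrier V; y \<in> carrier W\<rbrakk> \<Longrightarrow> tensor_lift Z \<beta> (pt x y) = \<beta> x y"
proof -
  interpret Z: abelian_group Z by fact
  interpret N: normal N F by (rule null_normal)
  define h :: "('x \<times> 'y \<Rightarrow>\<^sub>0 int) \<Rightarrow> _" where "h c = (\<Oplus>\<^bsub>Z\<^esub>p\<in>Poly_Mapping.keys c.
                    add_pow Z (Poly_Mapping.lookup c p) (\<beta> (fst p) (snd p)))" for c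
  have \<beta>_closed: "\<beta> x y \<in> carrier Z" if "x \<in> carrier V" "y \<in> carrier W" for x y
    using \<beta> that by (auto simp: balanced_map_def intro: additive_closed)
  have "h \<in> hom F (add_monoid Z)"
    unfolding h_def[abs_def]
    by (rule Z.add.frag_evaluation_hom) (auto intro: \<beta>_closed)
  then interpret h: group_hom F "add_monoid Z" h
    by (simp add: group_hom_def group_hom_axioms_def Z.add.is_group)
  have h_add: "h (c + d) = h c \<oplus>\<^bsub>Z\<^esub> h d" if "c \<in> carrier F" "d \<in> carrier F" for c d
    using h.hom_mult[OF that] by simp
  have diffF: "c - d \<in> carrier F" if "c \<in> carrier F" "d \<in> carrier F" for c d :: "('x \<times> 'y) \<Rightarrow>\<^sub>0 int"
    using that keys_diff[of c d] by auto
  have h_closed: "h c \<in> carrier Z" if "c \<in> carrier F" for c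
    using h.hom_closed[OF that] by simp
  have h_diff: "h (c - d) = h c \<oplus>\<^bsub>Z\<^esub> (\<ominus>\<^bsub>Z\<^esub> h d)" if cd: "c \<in> carrier F" "d \<in> carrier F" for c d
  proof -
    have "h (c - d) \<oplus>\<^bsub>Z\<^esub> h d = h c"
      using h_add[OF diffF[OF cd] cd(2)] by simp
    then show ?thesis
      using h_closed[OF cd(1)] h_closed[OF cd(2)] h_closed[OF diffF[OF cd]]
      by (metis Z.a_assoc Z.a_inv_closed Z.r_neg Z.r_zero)
  qed
  have h_frag: "h (frag_of (x, y)) = \<beta> x y" if "x \<in> carrier V" "y \<in> carrier W" for x y
  proof -
    have "h (frag_of (x, y)) = \<beta> x y \<oplus>\<^bsub>Z\<^esub> \<zero>\<^bsub>Z\<^esub>"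
      using \<beta>_closed[OF that] Z.add.int_pow_1 unfolding h_def keys_frag_of
      by (subst Z.finsum_insert) auto
    then show ?thesis using \<beta>_closed[OF that] by simp
  qed
  have fragF: "frag_of (x, y) \<in> carrier F" if "x \<in> carrier V" "y \<in> carrier W" for x y
    using that by simp
  have add1: "\<beta> (x \<oplus>\<^bsub>V\<^esub> x') y = \<beta> x y \<oplus>\<^bsub>Z\<^esub> \<beta> x' y" if "x \<in> carrier V" "x' \<in> carrier V" "y \<in> carrier W" for x x' y
    using \<beta> that by (auto simp: balanced_map_def additive_map_def)
  have add2: "\<beta> x (y \<oplus>\<^bsub>W\<^esub> y') = \<beta> x y \<oplus>\<^bsub>Z\<^esub> \<beta> x y'" if "x \<in> carrier V" "y \<in> carrier W" "y' \<in> carrier W" for x y y'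
    using \<beta> that by (auto simp: balanced_map_def additive_map_def)
  have cancel: "a \<oplus>\<^bsub>Z\<^esub> b \<oplus>\<^bsub>Z\<^esub> (\<ominus>\<^bsub>Z\<^esub> a) \<oplus>\<^bsub>Z\<^esub> (\<ominus>\<^bsub>Z\<^esub> b) = \<zero>\<^bsub>Z\<^esub>"
    if "a \<in> carrier Z" "b \<in> carrier Z" for a b
  proof -
    have "(\<ominus>\<^bsub>Z\<^esub> a) \<oplus>\<^bsub>Z\<^esub> (\<ominus>\<^bsub>Z\<^esub> b) = \<ominus>\<^bsub>Z\<^esub> (a \<oplus>\<^bsub>Z\<^esub> b)"
      by (rule Z.minus_add[OF that, symmetric])
    moreover have "a \<oplus>\<^bsub>Z\<^esub> b \<oplus>\<^bsub>Z\<^esub> (\<ominus>\<^bsub>Z\<^esub> a) \<oplus>\<^bsub>Z\<^esub> (\<ominus>\<^bsub>Z\<^esub> b) =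
        (a \<oplus>\<^bsub>Z\<^esub> b) \<oplus>\<^bsub>Z\<^esub> ((\<ominus>\<^bsub>Z\<^esub> a) \<oplus>\<^bsub>Z\<^esub> (\<ominus>\<^bsub>Z\<^esub> b))"
      by (rule Z.a_assoc) (use that in simp_all)
    moreover have "(a \<oplus>\<^bsub>Z\<^esub> b) \<oplus>\<^bsub>Z\<^esub> (\<ominus>\<^bsub>Z\<^esub> (a \<oplus>\<^bsub>Z\<^esub> b)) = \<zero>\<^bsub>Z\<^esub>"
      by (rule Z.r_neg) (use that in simp)
    ultimately show ?thesis by (simp only:)
  qed
  have h_rel: "h c = \<zero>\<^bsub>Z\<^esub>" if c: "c \<in> tensor_relations R ract V W" for c
    using c unfolding tensor_relations_def
  proof (elim UnE CollectE exE conjE)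
    fix x x' y
    assume c: "c = frag_of (x \<oplus>\<^bsub>V\<^esub> x', y) - frag_of (x, y) - frag_of (x', y)"
      and xy: "x \<in> carrier V" "x' \<in> carrier V" "y \<in> carrier W"
    have "h c = \<beta> (x \<oplus>\<^bsub>V\<^esub> x') y \<oplus>\<^bsub>Z\<^esub> (\<ominus>\<^bsub>Z\<^esub> \<beta> x y) \<oplus>\<^bsub>Z\<^esub> (\<ominus>\<^bsub>Z\<^esub> \<beta> x' y)"
      using xy by (simp only: c h_diff h_frag fragF diffF V.a_closed)
    then show "h c = \<zero>\<^bsub>Z\<^esub>"
      using xy by (simp only: add1 cancel \<beta>_closed)
  next
    fix x y y'
    assume c: "c = frag_of (x, y \<oplus>\<^bsub>W\<^esub> y') - frag_of (x, y) - frag_of (x, y')"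
      and xy: "x \<in> carrier V" "y \<in> carrier W" "y' \<in> carrier W"
    have "h c = \<beta> x (y \<oplus>\<^bsub>W\<^esub> y') \<oplus>\<^bsub>Z\<^esub> (\<ominus>\<^bsub>Z\<^esub> \<beta> x y) \<oplus>\<^bsub>Z\<^esub> (\<ominus>\<^bsub>Z\<^esub> \<beta> x y')"
      using xy by (simp only: c h_diff h_frag fragF diffF W.a_closed)
    then show "h c = \<zero>\<^bsub>Z\<^esub>"
      using xy by (simp only: add2 cancel \<beta>_closed)
  next
    fix x r y
    assume c: "c = frag_of (ract x r, y) - frag_of (x, r \<odot>\<^bsub>W\<^esub> y)"
      and xy: "x \<in> carrier V" "r \<in> carrier R" "y \<in> carrier W"
    have "h c = \<beta> (ract x r) y \<oplus>\<^bsub>Z\<^esub> (\<ominus>\<^bsub>Z\<^esub> \<beta> x (r \<odot>\<^bsub>W\<^esub> y))"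
      using xy by (simp only: c h_diff h_frag fragF ract_closed lact_closed)
    also have "\<beta> (ract x r) y = \<beta> x (r \<odot>\<^bsub>W\<^esub> y)"
      using xy \<beta> by (simp add: balanced_map_def)
    finally show "h c = \<zero>\<^bsub>Z\<^esub>"
      using xy Z.r_neg[OF \<beta>_closed] by (simp only: lact_closed)
  qed
  have h_null: "h c = \<zero>\<^bsub>Z\<^esub>" if "c \<in> N" for c
  proof -
    have "tensor_relations R ract V W \<subseteq> kernel F (add_monoid Z) h"
      using subsetD[OF relations_subset] h_rel
      by (auto simp: kernel_def simp del: carrier_free_Abelian_group_iff)
    then have "N \<subseteq> kernel F (add_monoid Z) h"
      unfolding tensor_null_def
      by (rule group.generate_subgroup_incl[OF group_free_Abelian_group _ h.subgroup_kernel])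
    then show ?thesis using that by (auto simp: kernel_def)
  qed
  have lift_coset: "tensor_lift Z \<beta> (N #>\<^bsub>F\<^esub> c) = h c" if c: "c \<in> carrier F" for c
  proof -
    have "h ` (N #>\<^bsub>F\<^esub> c) = {h c}"
    proof -
      have "h d = h c" if d: "d \<in> N #>\<^bsub>F\<^esub> c" for d
      proof -
        obtain n where n: "n \<in> N" "d = n + c"
          using d by (auto simp: r_coset_def)
        have "n \<in> carrier F" using n(1) N.subset by (rule rev_subsetD)
        then have "h d = h n \<oplus>\<^bsub>Z\<^esub> h c"
          unfolding n(2) using c by (rule h_add)
        then show ?thesis
          using h_null[OF n(1)] h_closed[OF c] by simp
      qed
      moreover have "c \<in> N #>\<^bsub>F\<^esub> c"
        using N.rcos_self[OF c] N.is_subgroup by blast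
      ultimately show ?thesis by blast
    qed
    then show ?thesis
      unfolding tensor_lift_def h_def[symmetric] by simp
  qed
  show "additive_map T Z (tensor_lift Z \<beta>)"
  proof (rule additiveI)
    fix t assume "t \<in> carrier T"
    then show "tensor_lift Z \<beta> t \<in> carrier Z"
      by (auto simp: carrier_tensor lift_coset h_closed simp del: carrier_free_Abelian_group_iff)
  next
    fix t u assume "t \<in> carrier T" "u \<in> carrier T"
    then obtain c d where cd: "c \<in> carrier F" "d \<in> carrier F" "t = N #>\<^bsub>F\<^esub> c" "u = N #>\<^bsub>F\<^esub> d"
      by (auto simp: carrier_tensor)
    have "c + d \<in> carrier F"
      using cd(1,2) keys_add[of c d] by auto
    then show "tensor_lift Z \<beta> (t \<oplus>\<^bsub>T\<^esub> u) = tensor_lift Z \<beta> t \<oplus>\<^bsub>Z\<^esub> tensor_lift Z \<beta> u"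
      by (simp only: cd(3,4) add_cosets[OF cd(1,2)] lift_coset[OF cd(1)] lift_coset[OF cd(2)] lift_coset h_add[OF cd(1,2)])
  qed
  show "tensor_lift Z \<beta> (pt x y) = \<beta> x y" if "x \<in> carrier V" "y \<in> carrier W" for x y
    unfolding pure_tensor_def using lift_coset[OF fragF[OF that]] h_frag[OF that] by simp
qed

end

section \<open>The Temperley--Lieb algebras and their shift homomorphisms\<close>

lemma poly_mapping_single_induct [case_names single add zero]:
  fixes p :: "'a \<Rightarrow>\<^sub>0 'b::comm_monoid_add"
  assumes single: "\<And>w c. w \<in> Poly_Mapping.keys p \<Longrightarrow> P (Poly_Mapping.single w c)"
    and add: "\<And>q r. \<lbrakk>P q; P r\<rbrakk> \<Longrightarrow> P (q + r)" and zero: "P 0"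
  shows "P p"
proof -
  have "p = (\<Sum>w\<in>Poly_Mapping.keys p. Poly_Mapping.single w (Poly_Mapping.lookup p w))"
    by (rule poly_mapping_eqI) (auto simp: lookup_sum lookup_single when_def in_keys_iff)
  moreover have "P (\<Sum>w\<in>A. Poly_Mapping.single w (Poly_Mapping.lookup p w))"
    if "finite A" "A \<subseteq> Poly_Mapping.keys p" for A
    using that by (induction A) (auto intro: zero add single)
  ultimately show ?thesis by (metis finite_keys order_refl)
qed

lemma letters_zero [simp]: "letters 0 = []"
  by (simp add: zero_word_def)

lemma letters_plus [simp]: "letters (u + v) = letters u @ letters v"
  by (simp add: plus_word_def)

lemma carrier_free_algebra_iff:
  "p \<in> carrier (free_algebra N) \<longleftrightarrow> (\<forall>w\<in>Poly_Mapping.keys p. set (letters w) \<subseteq> {1..<N})"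
  by (simp add: free_algebra_def)

lemma free_algebra_simps [simp]:
  "x \<oplus>\<^bsub>free_algebra N\<^esub> y = x + y" "x \<otimes>\<^bsub>free_algebra N\<^esub> y = x * y"
  "\<one>\<^bsub>free_algebra N\<^esub> = 1" "\<zero>\<^bsub>free_algebra N\<^esub> = 0"
  by (simp_all add: free_algebra_def)

lemma free_algebra_single_closed:
  "set (letters w) \<subseteq> {1..<N} \<Longrightarrow> Poly_Mapping.single w c \<in> carrier (free_algebra N)"
  by (simp add: carrier_free_algebra_iff)

lemma free_algebra_ring: "ring (free_algebra N)"
proof (rule ringI)
  have add: "p + q \<in> carrier (free_algebra N)"
    if "p \<in> carrier (free_algebra N)" "q \<in> carrier (free_algebra N)" for p q
    using that keys_add[of p q] unfolding carrier_free_algebra_iff by blast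
  have neg: "- p \<in> carrier (free_algebra N)" if "p \<in> carrier (free_algebra N)" for p
  proof -
    have "Poly_Mapping.keys (- p) = Poly_Mapping.keys p" by (auto simp: in_keys_iff)
    then show ?thesis using that unfolding carrier_free_algebra_iff by simp
  qed
  show "abelian_group (free_algebra N)"
  proof (rule abelian_groupI)
    show "\<exists>y\<in>carrier (free_algebra N). y \<oplus>\<^bsub>free_algebra N\<^esub> x = \<zero>\<^bsub>free_algebra N\<^esub>"
      if "x \<in> carrier (free_algebra N)" for x
      using neg[OF that] by (intro bexI[of _ "- x"]) simp_all
  qed (simp_all add: add ac_simps carrier_free_algebra_iff[of 0])
  show "monoid (free_algebra N)"
  proof (rule monoidI)
    fix p q assume pq: "p \<in> carrier (free_algebra N)" "q \<in> carrier (free_algebra N)"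
    show "p \<otimes>\<^bsub>free_algebra N\<^esub> q \<in> carrier (free_algebra N)"
      unfolding carrier_free_algebra_iff
    proof
      fix w assume "w \<in> Poly_Mapping.keys (p \<otimes>\<^bsub>free_algebra N\<^esub> q)"
      then obtain u v where "w = u + v" "u \<in> Poly_Mapping.keys p" "v \<in> Poly_Mapping.keys q"
        using keys_mult[of p q] by auto
      then show "set (letters w) \<subseteq> {1..<N}"
        using pq unfolding carrier_free_algebra_iff by auto
    qed
  qed (auto simp: carrier_free_algebra_iff mult.assoc)
qed (simp_all add: distrib_left distrib_right)

lemma const_closed: "const c \<in> carrier (free_algebra N)"
  unfolding const_def by (rule free_algebra_single_closed) simp

lemma gen_closed: "j \<in> {1..<N} \<Longrightarrow> gen j \<in> carrier (free_algebra N)"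
  unfolding gen_def by (rule free_algebra_single_closed) simp

lemma const_commutes: "const c * p = p * const c"
proof (induction p rule: poly_mapping_single_induct)
  case (single w d)
  then show ?case by (simp add: const_def mult_single mult.commute)
qed (simp_all add: distrib_left distrib_right)

text \<open>
  The free algebra is generated by the scalars and the generators \<open>e\<^sub>j\<close>.
\<close>

lemma free_algebra_induct [consumes 1, case_names const gen add mult]:
  assumes p: "p \<in> carrier (free_algebra N)"
    and const: "\<And>c. P (const c)"
    and gen: "\<And>j. j \<in> {1..<N} \<Longrightarrow> P (gen j)"
    and add: "\<And>p q. \<lbrakk>p \<in> carrier (free_algebra N); q \<in> carrier (free_algebra N); P p; P q\<rbrakk> \<Longrightarrow> P (p + q)"
    and mult: "\<And>p q. \<lbrakk>p \<in> carrier (free_algebra N); q \<in> carrier (free_algebra N); P p; P q\<rbrakk> \<Longrightarrow> P (p * q)"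
  shows "P p"
proof -
  interpret ring "free_algebra N" by (rule free_algebra_ring)
  have word: "P (Poly_Mapping.single (Word ws) c)" if "set ws \<subseteq> {1..<N}" for ws c
    using that
  proof (induction ws)
    case Nil
    then show ?case using const[of c] by (simp add: const_def zero_word_def)
  next
    case (Cons j ws)
    have "Poly_Mapping.single (Word (j # ws)) c = gen j * Poly_Mapping.single (Word ws) c"
      by (simp add: gen_def mult_single plus_word_def)
    then show ?case
      using Cons by (auto intro!: mult gen gen_closed free_algebra_single_closed)
  qed
  have "p \<in> carrier (free_algebra N) \<and> P p"
  proof (induction p rule: poly_mapping_single_induct)
    case (single w c)
    then have "set (letters w) \<subseteq> {1..<N}" using p by (simp add: carrier_free_algebra_iff)
    then show ?case
      using word[of "letters w" c] by (simp add: free_algebra_single_closed)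
  next
    case (add q r)
    then show ?case using a_closed[of q r] assms(4) by simp
  next
    case zero
    then show ?case using zero_closed const[of 0] by (simp add: const_def)
  qed
  then show ?thesis ..
qed

lemma shift_letters_single:
  "shift_letters s (Poly_Mapping.single w c) = Poly_Mapping.single (Word (map ((+) s) (letters w))) c"
  by (cases "c = 0") (simp_all add: shift_letters_def)

lemma shift_letters_zero: "shift_letters s 0 = 0"
  by (simp add: shift_letters_def)

lemma shift_letters_add: "shift_letters s (p + q) = shift_letters s p + shift_letters s q"
  unfolding shift_letters_def
  by (rule setsum_keys_plus_distrib) (simp_all add: single_add)

lemma shift_letters_mult: "shift_letters s (p * q) = shift_letters s p * shift_letters s q"
proof (induction p rule: poly_mapping_single_induct)
  case (single u c)
  show ?case
    by (induction q rule: poly_mapping_single_induct)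
      (simp_all add: shift_letters_single mult_single plus_word_def distrib_left
        shift_letters_add shift_letters_zero)
qed (simp_all add: distrib_right shift_letters_add shift_letters_zero)

lemma shift_letters_const: "shift_letters s (const c) = const c"
  by (simp add: const_def shift_letters_single zero_word_def)

lemma shift_letters_gen: "shift_letters s (gen j) = gen (s + j)"
  by (simp add: gen_def shift_letters_single)

lemma one_eq_const: "1 = const 1"
  by (simp add: const_def)

lemma shift_letters_shift: "shift_letters s (shift_letters t p) = shift_letters (s + t) p"
proof (induction p rule: poly_mapping_single_induct)
  case (single w c)
  have "(\<lambda>x. s + (t + x)) = (+) (s + t)" by auto
  then show ?case by (simp add: shift_letters_single o_def)
qed (simp_all add: shift_letters_add shift_letters_zero)

lemma shift_letters_closed:
  assumes "p \<in> carrier (free_algebra N)" "s + N \<le> K"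
  shows "shift_letters s p \<in> carrier (free_algebra K)"
proof -
  interpret ring "free_algebra K" by (rule free_algebra_ring)
  show ?thesis
    using assms(1)
  proof (induction rule: free_algebra_induct)
    case (add p q)
    then show ?case using a_closed by (simp add: shift_letters_add)
  next
    case (mult p q)
    then show ?case using m_closed by (simp add: shift_letters_mult)
  qed (use assms(2) in \<open>auto simp: shift_letters_const shift_letters_gen const_closed intro!: gen_closed\<close>)
qed

lemma shift_letters_hom:
  assumes "s + N \<le> K"
  shows "shift_letters s \<in> ring_hom (free_algebra N) (free_algebra K)"
  by (rule ring_hom_memI)
    (use assms in \<open>auto simp: shift_letters_closed shift_letters_mult shift_letters_add
        one_eq_const shift_letters_const\<close>)

lemma TL_relations_subset: "TL_relations m N \<subseteq> carrier (free_algebra N)"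
proof -
  interpret ring "free_algebra N" by (rule free_algebra_ring)
  have keys_diff: "Poly_Mapping.keys (p - q) \<subseteq> Poly_Mapping.keys p \<union> Poly_Mapping.keys q"
    for p q :: "word \<Rightarrow>\<^sub>0 complex"
    by (auto simp: in_keys_iff lookup_minus)
  have diff: "p - q \<in> carrier (free_algebra N)"
    if "p \<in> carrier (free_algebra N)" "q \<in> carrier (free_algebra N)" for p q
    using that keys_diff[of p q] unfolding carrier_free_algebra_iff by blast
  note mult = m_closed[unfolded free_algebra_simps]
  show ?thesis
    unfolding TL_relations_def by (auto intro!: diff mult gen_closed const_closed)
qed

lemma TL_ideal_ideal: "ideal (TL_ideal m N) (free_algebra N)"
  unfolding TL_ideal_def by (rule ring.genideal_ideal[OF free_algebra_ring TL_relations_subset])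

lemma TL_relation_in_ideal: "p \<in> TL_relations m N \<Longrightarrow> p \<in> TL_ideal m N"
  unfolding TL_ideal_def using ring.genideal_self[OF free_algebra_ring TL_relations_subset] by blast

lemma TL_ring: "ring (TL m N)"
  unfolding TL_def by (rule ideal.quotient_is_ring[OF TL_ideal_ideal])

lemma TL_class_hom: "TL_class m N \<in> ring_hom (free_algebra N) (TL m N)"
  unfolding TL_def TL_class_def[abs_def] by (rule ideal.rcos_ring_hom[OF TL_ideal_ideal])

lemma TL_class_closed: "p \<in> carrier (free_algebra N) \<Longrightarrow> TL_class m N p \<in> carrier (TL m N)"
  by (rule ring_hom_closed[OF TL_class_hom])

lemma TL_class_add:
  "\<lbrakk>p \<in> carrier (free_algebra N); q \<in> carrier (free_algebra N)\<rbrakk> \<Longrightarrow>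
    TL_class m N (p + q) = TL_class m N p \<oplus>\<^bsub>TL m N\<^esub> TL_class m N q"
  using ring_hom_add[OF TL_class_hom] by simp

lemma TL_class_mult:
  "\<lbrakk>p \<in> carrier (free_algebra N); q \<in> carrier (free_algebra N)\<rbrakk> \<Longrightarrow>
    TL_class m N (p * q) = TL_class m N p \<otimes>\<^bsub>TL m N\<^esub> TL_class m N q"
  using ring_hom_mult[OF TL_class_hom] by simp

lemma TL_class_one: "TL_class m N 1 = \<one>\<^bsub>TL m N\<^esub>"
  using ring_hom_one[OF TL_class_hom] by simp

lemma TL_carrier: "carrier (TL m N) = TL_class m N ` carrier (free_algebra N)"
  by (auto simp: TL_def TL_class_def[abs_def] FactRing_def A_RCOSETS_def' )

lemma TL_carrierE:
  assumes "a \<in> carrier (TL m N)"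
  obtains p where "p \<in> carrier (free_algebra N)" "a = TL_class m N p"
  using assms unfolding TL_carrier by blast

lemma TL_class_eqI:
  assumes "p \<in> carrier (free_algebra N)" "q \<in> carrier (free_algebra N)" "p - q \<in> TL_ideal m N"
  shows "TL_class m N p = TL_class m N q"
proof -
  interpret I: ideal "TL_ideal m N" "free_algebra N" by (rule TL_ideal_ideal)
  have "p = (p - q) \<oplus>\<^bsub>free_algebra N\<^esub> q" by simp
  then have "p \<in> TL_ideal m N +>\<^bsub>free_algebra N\<^esub> q"
    using assms(3) unfolding a_r_coset_def' by blast
  then show ?thesis
    unfolding TL_class_def
    using I.a_repr_independence[OF _ assms(2)] I.a_subgroup by metis
qed

text \<open>
  Raising all indices by \<open>s\<close> maps defining relations to defining relations.  The preimage of the ideal is then an ideal containing the relations.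
\<close>

lemma shift_letters_ideal:
  assumes sN: "s + N \<le> K" and p: "p \<in> TL_ideal m N"
  shows "shift_letters s p \<in> TL_ideal m K"
proof -
  interpret N: ring "free_algebra N" by (rule free_algebra_ring)
  interpret h: ring_hom_ring "free_algebra N" "free_algebra K" "shift_letters s"
    by (rule ring_hom_ringI2[OF free_algebra_ring free_algebra_ring shift_letters_hom[OF sN]])
  have minus: "shift_letters s (p - q) = shift_letters s p - shift_letters s q" for p q
    using shift_letters_add[of s "p - q" q] by (simp add: algebra_simps)
  note shift = minus shift_letters_mult shift_letters_gen shift_letters_const
  have rel: "shift_letters s p \<in> TL_relations m K" if "p \<in> TL_relations m N" for p
    using that unfolding TL_relations_def
  proof (elim UnE CollectE exE conjE)
    fix j assume "p = gen j * gen j - const m * gen j" "j \<in> {1..<N}"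
    then have "shift_letters s p = gen (s + j) * gen (s + j) - const m * gen (s + j)" "s + j \<in> {1..<K}"
      using sN by (auto simp: shift)
    then show "shift_letters s p \<in> {gen j * gen j - const m * gen j | j. j \<in> {1..<K}} \<union>
      {gen j * gen k * gen j - gen j | j k. j \<in> {1..<K} \<and> k \<in> {1..<K} \<and> \<bar>int j - int k\<bar> = 1} \<union>
      {gen j * gen k - gen k * gen j | j k. j \<in> {1..<K} \<and> k \<in> {1..<K} \<and> \<bar>int j - int k\<bar> > 1}" by blast
  next
    fix j k assume "p = gen j * gen k * gen j - gen j" "j \<in> {1..<N}" "k \<in> {1..<N}" "\<bar>int j - int k\<bar> = 1"
    then have "shift_letters s p = gen (s + j) * gen (s + k) * gen (s + j) - gen (s + j)"
      "s + j \<in> {1..<K}" "s + k \<in> {1..<K}" "\<bar>int (s + j) - int (s + k)\<bar> = 1"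
      using sN by (auto simp: shift)
    then show "shift_letters s p \<in> {gen j * gen j - const m * gen j | j. j \<in> {1..<K}} \<union>
      {gen j * gen k * gen j - gen j | j k. j \<in> {1..<K} \<and> k \<in> {1..<K} \<and> \<bar>int j - int k\<bar> = 1} \<union>
      {gen j * gen k - gen k * gen j | j k. j \<in> {1..<K} \<and> k \<in> {1..<K} \<and> \<bar>int j - int k\<bar> > 1}" by blast
  next
    fix j k assume "p = gen j * gen k - gen k * gen j" "j \<in> {1..<N}" "k \<in> {1..<N}" "\<bar>int j - int k\<bar> > 1"
    then have "shift_letters s p = gen (s + j) * gen (s + k) - gen (s + k) * gen (s + j)"
      "s + j \<in> {1..<K}" "s + k \<in> {1..<K}" "\<bar>int (s + j) - int (s + k)\<bar> > 1"
      using sN by (auto simp: shift)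
    then show "shift_letters s p \<in> {gen j * gen j - const m * gen j | j. j \<in> {1..<K}} \<union>
      {gen j * gen k * gen j - gen j | j k. j \<in> {1..<K} \<and> k \<in> {1..<K} \<and> \<bar>int j - int k\<bar> = 1} \<union>
      {gen j * gen k - gen k * gen j | j k. j \<in> {1..<K} \<and> k \<in> {1..<K} \<and> \<bar>int j - int k\<bar> > 1}" by blast
  qed
  have "ideal {r \<in> carrier (free_algebra N). shift_letters s r \<in> TL_ideal m K} (free_algebra N)"
    by (rule h.ideal_vimage[OF TL_ideal_ideal])
  then have "TL_ideal m N \<subseteq> {r \<in> carrier (free_algebra N). shift_letters s r \<in> TL_ideal m K}"
    unfolding TL_ideal_def[of m N]
    by (rule N.genideal_minimal) (use rel TL_relation_in_ideal TL_relations_subset in blast)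
  then show ?thesis using p by blast
qed

text \<open>
  Independence of the representative, which turns \<^const>\<open>TL_shift\<close> from a choice of the unique element
  of an image into a usable formula.
\<close>

lemma TL_shift_class:
  assumes "s + N \<le> K" "p \<in> carrier (free_algebra N)"
  shows "TL_shift m s N K (TL_class m N p) = TL_class m K (shift_letters s p)"
proof -
  interpret I: ideal "TL_ideal m N" "free_algebra N" by (rule TL_ideal_ideal)
  have eq: "TL_class m K (shift_letters s q) = TL_class m K (shift_letters s p)" if q: "q \<in> TL_class m N p" for q
  proof -
    obtain i where i: "i \<in> TL_ideal m N" "q = i + p"
      using q by (auto simp: TL_class_def a_r_coset_def')
    have "i \<in> carrier (free_algebra N)" using i(1) I.a_subset by blast
    then show ?thesis
      by (intro TL_class_eqI shift_letters_closed[OF _ assms(1)])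
        (use assms i I.a_closed[of i p] in \<open>simp_all add: shift_letters_add shift_letters_ideal\<close>)
  qed
  have "p \<in> TL_class m N p"
    unfolding TL_class_def using I.a_rcos_self[OF assms(2)] .
  then have "(\<lambda>q. TL_class m K (shift_letters s q)) ` TL_class m N p = {TL_class m K (shift_letters s p)}"
    using eq by blast
  then show ?thesis unfolding TL_shift_def by simp
qed

lemma TL_shift_hom:
  assumes "s + N \<le> K"
  shows "TL_shift m s N K \<in> ring_hom (TL m N) (TL m K)"
proof -
  interpret N: ring "free_algebra N" by (rule free_algebra_ring)
  note shift = TL_shift_class[OF assms] shift_letters_closed[OF _ assms]
  show ?thesis
  proof (rule ring_hom_memI)
    fix a assume "a \<in> carrier (TL m N)"
    then show "TL_shift m s N K a \<in> carrier (TL m K)"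
      by (elim TL_carrierE) (simp add: shift TL_class_closed)
  next
    fix a b assume "a \<in> carrier (TL m N)" "b \<in> carrier (TL m N)"
    then obtain p q where pq: "p \<in> carrier (free_algebra N)" "q \<in> carrier (free_algebra N)"
        "a = TL_class m N p" "b = TL_class m N q"
      by (elim TL_carrierE)
    show "TL_shift m s N K (a \<otimes>\<^bsub>TL m N\<^esub> b) = TL_shift m s N K a \<otimes>\<^bsub>TL m K\<^esub> TL_shift m s N K b"
      using pq N.m_closed[of p q]
      by (simp add: TL_class_mult[symmetric] shift shift_letters_mult)
    show "TL_shift m s N K (a \<oplus>\<^bsub>TL m N\<^esub> b) = TL_shift m s N K a \<oplus>\<^bsub>TL m K\<^esub> TL_shift m s N K b"
      using pq N.a_closed[of p q]
      by (simp add: TL_class_add[symmetric] shift shift_letters_add)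
  next
    show "TL_shift m s N K \<one>\<^bsub>TL m N\<^esub> = \<one>\<^bsub>TL m K\<^esub>"
      using const_closed[of 1 N]
      by (simp add: TL_class_one[symmetric] one_eq_const shift shift_letters_const)
  qed
qed

lemma TL_shift_const:
  "s + N \<le> K \<Longrightarrow> TL_shift m s N K (TL_class m N (const c)) = TL_class m K (const c)"
  by (simp add: TL_shift_class const_closed shift_letters_const)

lemma TL_shift_shift:
  assumes "t + N \<le> K" "s + K \<le> L" "a \<in> carrier (TL m N)"
  shows "TL_shift m s K L (TL_shift m t N K a) = TL_shift m (s + t) N L a"
  using assms(3)
  by (elim TL_carrierE) (use assms(1,2) in \<open>simp add: TL_shift_class shift_letters_closed shift_letters_shift\<close>)

lemma TL_const_central:
  assumes "a \<in> carrier (TL m N)"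
  shows "TL_class m N (const c) \<otimes>\<^bsub>TL m N\<^esub> a = a \<otimes>\<^bsub>TL m N\<^esub> TL_class m N (const c)"
  using assms
  by (elim TL_carrierE) (simp add: TL_class_mult[symmetric] const_closed const_commutes)

text \<open>
  The elements commuting with \<open>z\<close> form a subalgebra, so commutation can be tested on generators.
\<close>

lemma TL_commutant_closure:
  assumes "p \<in> carrier (free_algebra N)" "s + N \<le> K" "z \<in> carrier (TL m K)"
    and gen: "\<And>j. j \<in> {1..<N} \<Longrightarrow>
      TL_class m K (gen (s + j)) \<otimes>\<^bsub>TL m K\<^esub> z = z \<otimes>\<^bsub>TL m K\<^esub> TL_class m K (gen (s + j))"
  shows "TL_class m K (shift_letters s p) \<otimes>\<^bsub>TL m K\<^esub> z = z \<otimes>\<^bsub>TL m K\<^esub> TL_class m K (shift_letters s p)"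
proof -
  interpret ring "TL m K" by (rule TL_ring)
  note cl = shift_letters_closed[OF _ assms(2)] TL_class_closed
  show ?thesis
    using assms(1)
  proof (induction rule: free_algebra_induct)
    case (const c)
    then show ?case using TL_const_central[OF assms(3)] by (simp add: shift_letters_const)
  next
    case (gen j)
    then show ?case using assms(4) by (simp add: shift_letters_gen)
  next
    case (add p q)
    then show ?case
      using assms(3) by (simp add: shift_letters_add TL_class_add cl l_distr r_distr)
  next
    case (mult p q)
    let ?p = "TL_class m K (shift_letters s p)" and ?q = "TL_class m K (shift_letters s q)"
    have pq: "?p \<in> carrier (TL m K)" "?q \<in> carrier (TL m K)" using mult by (simp_all add: cl)
    have "(?p \<otimes>\<^bsub>TL m K\<^esub> ?q) \<otimes>\<^bsub>TL m K\<^esub> z = z \<otimes>\<^bsub>TL m K\<^esub> (?p \<otimes>\<^bsub>TL m K\<^esub> ?q)"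
      using mult.IH pq assms(3) by (metis m_assoc)
    then show ?case
      using mult.hyps by (simp add: shift_letters_mult TL_class_mult cl)
  qed
qed

text \<open>
  If \<open>N \<le> s\<close>, the left factor involves \<open>e\<^sub>j\<close> with \<open>j < N\<close> and the right one \<open>e\<^sub>k\<close> with \<open>k > s\<close>, so
  \<open>k - j \<ge> 2\<close>: this is where it matters that \<open>TL\<^sub>N\<close> has only \<open>N - 1\<close> generators.
\<close>

lemma TL_shift_commute:
  assumes "N \<le> s" "s + M \<le> K" "a \<in> carrier (TL m N)" "b \<in> carrier (TL m M)"
  shows "TL_shift m 0 N K a \<otimes>\<^bsub>TL m K\<^esub> TL_shift m s M K b =
         TL_shift m s M K b \<otimes>\<^bsub>TL m K\<^esub> TL_shift m 0 N K a"
proof -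
  obtain p where p: "p \<in> carrier (free_algebra N)" "a = TL_class m N p"
    using assms(3) by (rule TL_carrierE)
  obtain q where q: "q \<in> carrier (free_algebra M)" "b = TL_class m M q"
    using assms(4) by (rule TL_carrierE)
  interpret K: ring "free_algebra K" by (rule free_algebra_ring)
  have gens: "TL_class m K (gen j) \<otimes>\<^bsub>TL m K\<^esub> TL_class m K (gen k) =
      TL_class m K (gen k) \<otimes>\<^bsub>TL m K\<^esub> TL_class m K (gen j)"
    if "j \<in> {1..<N}" "k \<in> {s + 1..<s + M}" for j k
  proof -
    have jk: "j \<in> {1..<K}" "k \<in> {1..<K}" "\<bar>int j - int k\<bar> > 1"
      using that assms(1,2) by auto
    have "gen j * gen k - gen k * gen j \<in> TL_ideal m K"
      by (rule TL_relation_in_ideal) (use jk in \<open>unfold TL_relations_def, blast\<close>)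
    then have "TL_class m K (gen j * gen k) = TL_class m K (gen k * gen j)"
      using jk K.m_closed[of "gen j" "gen k"] K.m_closed[of "gen k" "gen j"]
      by (intro TL_class_eqI) (simp_all add: gen_closed)
    then show ?thesis using jk by (simp add: TL_class_mult gen_closed)
  qed
  have "TL_class m K (shift_letters 0 p) \<otimes>\<^bsub>TL m K\<^esub> TL_class m K (gen (s + k)) =
      TL_class m K (gen (s + k)) \<otimes>\<^bsub>TL m K\<^esub> TL_class m K (shift_letters 0 p)" if "k \<in> {1..<M}" for k
  proof (rule TL_commutant_closure[OF p(1)])
    show "TL_class m K (gen (0 + j)) \<otimes>\<^bsub>TL m K\<^esub> TL_class m K (gen (s + k)) =
        TL_class m K (gen (s + k)) \<otimes>\<^bsub>TL m K\<^esub> TL_class m K (gen (0 + j))" if "j \<in> {1..<N}" for j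
      using gens[of j "s + k"] that \<open>k \<in> {1..<M}\<close> by simp
  qed (use that assms in \<open>auto intro!: TL_class_closed gen_closed\<close>)
  then have "TL_class m K (shift_letters s q) \<otimes>\<^bsub>TL m K\<^esub> TL_class m K (shift_letters 0 p) =
      TL_class m K (shift_letters 0 p) \<otimes>\<^bsub>TL m K\<^esub> TL_class m K (shift_letters s q)"
    using assms p q
    by (intro TL_commutant_closure) (auto intro!: TL_class_closed shift_letters_closed)
  then show ?thesis
    using p q assms by (simp add: TL_shift_class)
qed

section \<open>Modules and the tensor product over the complex numbers\<close>

lemma with_smult_simps [simp]:
  "carrier (with_smult G act) = carrier G" "x \<oplus>\<^bsub>with_smult G act\<^esub> y = x \<oplus>\<^bsub>G\<^esub> y"
  "\<zero>\<^bsub>with_smult G act\<^esub> = \<zero>\<^bsub>G\<^esub>" "r \<odot>\<^bsub>with_smult G act\<^esub> x = act r x"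
  by (simp_all add: with_smult_def)

lemma additive_with_smult [simp]:
  "additive_map (with_smult G act) H f \<longleftrightarrow> additive_map G H f"
  "additive_map G (with_smult H act') f \<longleftrightarrow> additive_map G H f"
  by (simp_all add: additive_map_def)

lemma with_smult_abelian_group: "abelian_group G \<Longrightarrow> abelian_group (with_smult G act)"
proof -
  assume "abelian_group G"
  then interpret abelian_group G .
  show ?thesis
    by (rule abelian_groupI) (auto simp: a_ac intro!: bexI[of _ "\<ominus>\<^bsub>G\<^esub> _"] l_neg)
qed

lemma left_module_additive:
  assumes "left_module R M"
  shows left_module_additive_right: "a \<in> carrier R \<Longrightarrow> additive_map M M (\<lambda>x. a \<odot>\<^bsub>M\<^esub> x)"
    and left_module_additive_left: "x \<in> carrier M \<Longrightarrow> additive_map R M (\<lambda>a. a \<odot>\<^bsub>M\<^esub> x)"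
proof -
  interpret left_module R M by fact
  show "a \<in> carrier R \<Longrightarrow> additive_map M M (\<lambda>x. a \<odot>\<^bsub>M\<^esub> x)"
    by (rule additiveI) (simp_all add: smult_closed smult_r_distr)
  show "x \<in> carrier M \<Longrightarrow> additive_map R M (\<lambda>a. a \<odot>\<^bsub>M\<^esub> x)"
    by (rule additiveI) (simp_all add: smult_closed smult_l_distr)
qed

lemma left_module_abelian_group: "left_module R M \<Longrightarrow> abelian_group M"
  by (simp add: left_module_def)

lemma cscale_closed:
  assumes "left_module (TL m N) M" "x \<in> carrier M"
  shows "cscale m N M c x \<in> carrier M"
  unfolding cscale_def using left_module.smult_closed[OF assms(1)] assms(2) TL_class_closed[OF const_closed] by blast

text \<open>
  Scalars are central in \<open>TL\<^sub>N\<close>.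
\<close>

lemma smult_cscale:
  assumes "left_module (TL m N) M" "a \<in> carrier (TL m N)" "x \<in> carrier M"
  shows "a \<odot>\<^bsub>M\<^esub> cscale m N M c x = cscale m N M c (a \<odot>\<^bsub>M\<^esub> x)"
proof -
  interpret left_module "TL m N" M by fact
  have c: "TL_class m N (const c) \<in> carrier (TL m N)"
    by (rule TL_class_closed[OF const_closed])
  show ?thesis
    unfolding cscale_def
    using smult_assoc[OF c assms(2,3)] smult_assoc[OF assms(2) c assms(3)] TL_const_central[OF assms(2)] by metis
qed

lemma TL_regular_simps [simp]:
  "carrier (TL_regular m N) = carrier (TL m N)" "x \<oplus>\<^bsub>TL_regular m N\<^esub> y = x \<oplus>\<^bsub>TL m N\<^esub> y"
  "a \<odot>\<^bsub>TL_regular m N\<^esub> x = a \<otimes>\<^bsub>TL m N\<^esub> x"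
  by (simp_all add: TL_regular_def)

lemma additive_TL_regular [simp]: "additive_map (TL_regular m N) H f \<longleftrightarrow> additive_map (TL m N) H f"
  by (simp add: TL_regular_def)

lemma TL_abelian_group: "abelian_group (TL m N)"
  using TL_ring by (rule ring.is_abelian_group)

lemma TL_regular_left_module: "left_module (TL m N) (TL_regular m N)"
proof -
  interpret ring "TL m N" by (rule TL_ring)
  show ?thesis
  proof (intro left_module.intro left_module_axioms.intro TL_ring)
    show "abelian_group (TL_regular m N)"
      unfolding TL_regular_def by (rule with_smult_abelian_group[OF TL_abelian_group])
  qed (simp_all add: l_distr r_distr m_assoc)
qed

locale fusion_pair =
  fixes m :: complex and N1 N2 :: nat and M1 :: "(tl, 'x) module" and M2 :: "(tl, 'y) module"
  assumes left_module1: "left_module (TL m N1) M1" and left_module2: "left_module (TL m N2) M2"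
begin

abbreviation "ct \<equiv> ctensor m N1 N2 M1 M2"
abbreviation "cp \<equiv> cpure m N1 N2 M1 M2"

lemma abelian_group1: "abelian_group M1" and abelian_group2: "abelian_group M2"
  using left_module1 left_module2 by (simp_all add: left_module_abelian_group)

lemma smult1_closed: "\<lbrakk>a \<in> carrier (TL m N1); x \<in> carrier M1\<rbrakk> \<Longrightarrow> a \<odot>\<^bsub>M1\<^esub> x \<in> carrier M1"
  and smult2_closed: "\<lbrakk>b \<in> carrier (TL m N2); y \<in> carrier M2\<rbrakk> \<Longrightarrow> b \<odot>\<^bsub>M2\<^esub> y \<in> carrier M2"
  using left_module.smult_closed[OF left_module1] left_module.smult_closed[OF left_module2] by blast+

lemma ctensor_factors:
  "tensor_factors ring_of_type_algebra (\<lambda>x c. cscale m N1 M1 c x) M1 (with_smult M2 (cscale m N2 M2))"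
  by (intro tensor_factors.intro tensor_factors_axioms.intro abelian_group1
      with_smult_abelian_group abelian_group2)
    (simp_all add: cscale_closed left_module1 left_module2)

lemma ctensor_abelian_group: "abelian_group ct"
  unfolding ctensor_def by (rule tensor_factors.tensor_abelian_group[OF ctensor_factors])

lemma cpure_closed: "\<lbrakk>x \<in> carrier M1; y \<in> carrier M2\<rbrakk> \<Longrightarrow> cp x y \<in> carrier ct"
  unfolding ctensor_def cpure_def using tensor_factors.pure_closed[OF ctensor_factors] by simp

lemma cpure_additive:
  shows cpure_additive_left: "y \<in> carrier M2 \<Longrightarrow> additive_map M1 ct (\<lambda>x. cp x y)"
    and cpure_additive_right: "x \<in> carrier M1 \<Longrightarrow> additive_map M2 ct (\<lambda>y. cp x y)"
  using tensor_factors.pure_balanced_map[OF ctensor_factors]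
  unfolding ctensor_def cpure_def balanced_map_def by simp_all

lemma cpure_cscale:
  "\<lbrakk>x \<in> carrier M1; y \<in> carrier M2\<rbrakk> \<Longrightarrow> cp (cscale m N1 M1 c x) y = cp x (cscale m N2 M2 c y)"
  unfolding cpure_def using tensor_factors.pure_balanced[OF ctensor_factors, of x c y]
  by (simp add: ring_of_type_algebra_def)

lemma ctensor_induct [consumes 1, case_names pure add]:
  assumes "t \<in> carrier ct"
    and "\<And>x y. \<lbrakk>x \<in> carrier M1; y \<in> carrier M2\<rbrakk> \<Longrightarrow> P (cp x y)"
    and "\<And>t u. \<lbrakk>t \<in> carrier ct; u \<in> carrier ct; P t; P u\<rbrakk> \<Longrightarrow> P (t \<oplus>\<^bsub>ct\<^esub> u)"
  shows "P t"
  using tensor_factors.tensor_induct[OF ctensor_factors, of t P] assms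
  unfolding ctensor_def cpure_def by simp

lemma ctensor_ext:
  assumes "additive_map ct Z f" "additive_map ct Z g"
    and "\<And>x y. \<lbrakk>x \<in> carrier M1; y \<in> carrier M2\<rbrakk> \<Longrightarrow> f (cp x y) = g (cp x y)"
    and "t \<in> carrier ct"
  shows "f t = g t"
  using assms(4)
  by (induction rule: ctensor_induct) (simp_all add: assms(3) additive_add[OF assms(1)] additive_add[OF assms(2)])

lemma ctensor_lift:
  assumes Z: "abelian_group Z"
    and add2: "\<And>x. x \<in> carrier M1 \<Longrightarrow> additive_map M2 Z (\<beta> x)"
    and add1: "\<And>y. y \<in> carrier M2 \<Longrightarrow> additive_map M1 Z (\<lambda>x. \<beta> x y)"
    and bal: "\<And>x y c. \<lbrakk>x \<in> carrier M1; y \<in> carrier M2\<rbrakk> \<Longrightarrow>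
      \<beta> (cscale m N1 M1 c x) y = \<beta> x (cscale m N2 M2 c y)"
  shows ctensor_lift_additive: "additive_map ct Z (tensor_lift Z \<beta>)"
    and ctensor_lift_pure: "\<And>x y. \<lbrakk>x \<in> carrier M1; y \<in> carrier M2\<rbrakk> \<Longrightarrow> tensor_lift Z \<beta> (cp x y) = \<beta> x y"
proof -
  have \<beta>: "balanced_map ring_of_type_algebra (\<lambda>x c. cscale m N1 M1 c x) M1
      (with_smult M2 (cscale m N2 M2)) Z \<beta>"
    by (rule balanced_mapI) (simp_all add: add1 add2 bal)
  show "additive_map ct Z (tensor_lift Z \<beta>)"
    unfolding ctensor_def by (rule tensor_factors.tensor_lift_additive[OF ctensor_factors Z \<beta>])
  show "tensor_lift Z \<beta> (cp x y) = \<beta> x y" if "x \<in> carrier M1" "y \<in> carrier M2" for x y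
    unfolding cpure_def using tensor_factors.tensor_lift_pure[OF ctensor_factors Z \<beta>] that by simp
qed

end

lemma regular_fusion_pair: "fusion_pair m N1 N2 (TL_regular m N1) (TL_regular m N2)"
  by (intro fusion_pair.intro TL_regular_left_module)

abbreviation "regular_tensor m N1 N2 \<equiv> ctensor m N1 N2 (TL_regular m N1) (TL_regular m N2)"
abbreviation "regular_pure m N1 N2 \<equiv> cpure m N1 N2 (TL_regular m N1) (TL_regular m N2)"

lemma carrier_TL_tensor [simp]: "carrier (TL_tensor m N1 N2) = carrier (regular_tensor m N1 N2)"
  by (simp add: TL_tensor_def Let_def)

text \<open>
  Balancedness over \<open>\<complex>\<close> holds because both shifts fix the scalars, and these are central.
\<close>

lemma TL_incl_properties:
  shows TL_incl_additive: "additive_map (regular_tensor m N1 N2) (TL m (N1 + N2)) (TL_incl m N1 N2)"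
    and TL_incl_pure: "\<And>a b. \<lbrakk>a \<in> carrier (TL m N1); b \<in> carrier (TL m N2)\<rbrakk> \<Longrightarrow>
      TL_incl m N1 N2 (regular_pure m N1 N2 a b) =
        TL_shift m 0 N1 (N1 + N2) a \<otimes>\<^bsub>TL m (N1 + N2)\<^esub> TL_shift m N1 N2 (N1 + N2) b"
proof -
  let ?K = "N1 + N2"
  interpret P: fusion_pair m N1 N2 "TL_regular m N1" "TL_regular m N2" by (rule regular_fusion_pair)
  interpret K: ring "TL m ?K" by (rule TL_ring)
  interpret R1: ring "TL m N1" by (rule TL_ring)
  interpret R2: ring "TL m N2" by (rule TL_ring)
  have h1: "TL_shift m 0 N1 ?K \<in> ring_hom (TL m N1) (TL m ?K)" by (rule TL_shift_hom) simp
  have h2: "TL_shift m N1 N2 ?K \<in> ring_hom (TL m N2) (TL m ?K)" by (rule TL_shift_hom) simp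
  note hom = ring_hom_closed[OF h1] ring_hom_closed[OF h2] ring_hom_add[OF h1] ring_hom_add[OF h2]
    ring_hom_mult[OF h1] ring_hom_mult[OF h2]
  have lift: "abelian_group (TL m ?K)"
    "\<And>a. a \<in> carrier (TL_regular m N1) \<Longrightarrow> additive_map (TL_regular m N2) (TL m ?K)
      (\<lambda>b. TL_shift m 0 N1 ?K a \<otimes>\<^bsub>TL m ?K\<^esub> TL_shift m N1 N2 ?K b)"
    "\<And>b. b \<in> carrier (TL_regular m N2) \<Longrightarrow> additive_map (TL_regular m N1) (TL m ?K)
      (\<lambda>a. TL_shift m 0 N1 ?K a \<otimes>\<^bsub>TL m ?K\<^esub> TL_shift m N1 N2 ?K b)"
    "\<And>a b c. \<lbrakk>a \<in> carrier (TL_regular m N1); b \<in> carrier (TL_regular m N2)\<rbrakk> \<Longrightarrow>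
      TL_shift m 0 N1 ?K (cscale m N1 (TL_regular m N1) c a) \<otimes>\<^bsub>TL m ?K\<^esub> TL_shift m N1 N2 ?K b =
      TL_shift m 0 N1 ?K a \<otimes>\<^bsub>TL m ?K\<^esub> TL_shift m N1 N2 ?K (cscale m N2 (TL_regular m N2) c b)"
  proof -
    fix a b c assume ab: "a \<in> carrier (TL_regular m N1)" "b \<in> carrier (TL_regular m N2)"
    let ?a = "TL_shift m 0 N1 ?K a" and ?b = "TL_shift m N1 N2 ?K b" and ?c = "TL_class m ?K (const c)"
    have cl: "?a \<in> carrier (TL m ?K)" "?b \<in> carrier (TL m ?K)" "?c \<in> carrier (TL m ?K)"
      using ab by (simp_all add: hom TL_class_closed const_closed)
    have "(?c \<otimes>\<^bsub>TL m ?K\<^esub> ?a) \<otimes>\<^bsub>TL m ?K\<^esub> ?b = ?a \<otimes>\<^bsub>TL m ?K\<^esub> (?c \<otimes>\<^bsub>TL m ?K\<^esub> ?b)"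
      using cl TL_const_central[OF cl(1), of c] by (simp add: K.m_assoc)
    then show "TL_shift m 0 N1 ?K (cscale m N1 (TL_regular m N1) c a) \<otimes>\<^bsub>TL m ?K\<^esub> ?b =
      ?a \<otimes>\<^bsub>TL m ?K\<^esub> TL_shift m N1 N2 ?K (cscale m N2 (TL_regular m N2) c b)"
      using ab by (simp add: cscale_def hom TL_class_closed const_closed TL_shift_const)
  qed (auto intro!: additiveI simp: TL_abelian_group hom K.l_distr K.r_distr)
  show "additive_map (regular_tensor m N1 N2) (TL m ?K) (TL_incl m N1 N2)"
    unfolding TL_incl_def by (rule P.ctensor_lift_additive[OF lift])
  show "TL_incl m N1 N2 (regular_pure m N1 N2 a b) =
      TL_shift m 0 N1 ?K a \<otimes>\<^bsub>TL m ?K\<^esub> TL_shift m N1 N2 ?K b"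
    if "a \<in> carrier (TL m N1)" "b \<in> carrier (TL m N2)" for a b
    unfolding TL_incl_def by (rule P.ctensor_lift_pure[OF lift]) (use that in simp_all)
qed

section \<open>The universal property of fusion\<close>

text \<open>
  The maps of three variables which factor through the fusion.  Balancedness over \<open>\<complex>\<close> is contained in
  the last two clauses, as \<open>fusion_lift_inner\<close> shows.
\<close>

definition fusion_balanced ::
    "complex \<Rightarrow> nat \<Rightarrow> nat \<Rightarrow> (tl, 'x) module \<Rightarrow> (tl, 'y) module \<Rightarrow> ('z, 'e) ring_scheme
      \<Rightarrow> (tl \<Rightarrow> 'x \<Rightarrow> 'y \<Rightarrow> 'z) \<Rightarrow> bool"
  where "fusion_balanced m N1 N2 M1 M2 Z \<beta> \<longleftrightarrow>
    (\<forall>x\<in>carrier M1. \<forall>y\<in>carrier M2. additive_map (TL m (N1 + N2)) Z (\<lambda>a. \<beta> a x y)) \<and>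
    (\<forall>a\<in>carrier (TL m (N1 + N2)). \<forall>y\<in>carrier M2. additive_map M1 Z (\<lambda>x. \<beta> a x y)) \<and>
    (\<forall>a\<in>carrier (TL m (N1 + N2)). \<forall>x\<in>carrier M1. additive_map M2 Z (\<lambda>y. \<beta> a x y)) \<and>
    (\<forall>a\<in>carrier (TL m (N1 + N2)). \<forall>b\<in>carrier (TL m N1). \<forall>x\<in>carrier M1. \<forall>y\<in>carrier M2.
      \<beta> (a \<otimes>\<^bsub>TL m (N1 + N2)\<^esub> TL_shift m 0 N1 (N1 + N2) b) x y = \<beta> a (b \<odot>\<^bsub>M1\<^esub> x) y) \<and>
    (\<forall>a\<in>carrier (TL m (N1 + N2)). \<forall>b\<in>carrier (TL m N2). \<forall>x\<in>carrier M1. \<forall>y\<in>carrier M2.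
      \<beta> (a \<otimes>\<^bsub>TL m (N1 + N2)\<^esub> TL_shift m N1 N2 (N1 + N2) b) x y = \<beta> a x (b \<odot>\<^bsub>M2\<^esub> y))"

text \<open>
  The sum \<open>N1 + N2\<close> is abstracted to \<open>K\<close> so that \<open>N1 + (N2 + N3)\<close> can be replaced by
  \<open>N1 + N2 + N3\<close> once and for all.
\<close>

lemma fusion_balancedI:
  assumes "N1 + N2 = K"
    and "\<And>x y. \<lbrakk>x \<in> carrier M1; y \<in> carrier M2\<rbrakk> \<Longrightarrow> additive_map (TL m K) Z (\<lambda>a. \<beta> a x y)"
    and "\<And>a y. \<lbrakk>a \<in> carrier (TL m K); y \<in> carrier M2\<rbrakk> \<Longrightarrow> additive_map M1 Z (\<lambda>x. \<beta> a x y)"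
    and "\<And>a x. \<lbrakk>a \<in> carrier (TL m K); x \<in> carrier M1\<rbrakk> \<Longrightarrow> additive_map M2 Z (\<lambda>y. \<beta> a x y)"
    and "\<And>a b x y. \<lbrakk>a \<in> carrier (TL m K); b \<in> carrier (TL m N1); x \<in> carrier M1; y \<in> carrier M2\<rbrakk> \<Longrightarrow>
      \<beta> (a \<otimes>\<^bsub>TL m K\<^esub> TL_shift m 0 N1 K b) x y = \<beta> a (b \<odot>\<^bsub>M1\<^esub> x) y"
    and "\<And>a b x y. \<lbrakk>a \<in> carrier (TL m K); b \<in> carrier (TL m N2); x \<in> carrier M1; y \<in> carrier M2\<rbrakk> \<Longrightarrow>
      \<beta> (a \<otimes>\<^bsub>TL m K\<^esub> TL_shift m N1 N2 K b) x y = \<beta> a x (b \<odot>\<^bsub>M2\<^esub> y)"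
  shows "fusion_balanced m N1 N2 M1 M2 Z \<beta>"
  using assms(2-) unfolding fusion_balanced_def assms(1)[symmetric] by simp

lemma fusion_balancedD:
  assumes "fusion_balanced m N1 N2 M1 M2 Z \<beta>" "N1 + N2 = K"
  shows "\<lbrakk>x \<in> carrier M1; y \<in> carrier M2\<rbrakk> \<Longrightarrow> additive_map (TL m K) Z (\<lambda>a. \<beta> a x y)"
    and "\<lbrakk>a \<in> carrier (TL m K); y \<in> carrier M2\<rbrakk> \<Longrightarrow> additive_map M1 Z (\<lambda>x. \<beta> a x y)"
    and "\<lbrakk>a \<in> carrier (TL m K); x \<in> carrier M1\<rbrakk> \<Longrightarrow> additive_map M2 Z (\<lambda>y. \<beta> a x y)"
    and "\<lbrakk>a \<in> carrier (TL m K); b \<in> carrier (TL m N1); x \<in> carrier M1; y \<in> carrier M2\<rbrakk> \<Longrightarrow>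
      \<beta> (a \<otimes>\<^bsub>TL m K\<^esub> TL_shift m 0 N1 K b) x y = \<beta> a (b \<odot>\<^bsub>M1\<^esub> x) y"
    and "\<lbrakk>a \<in> carrier (TL m K); b \<in> carrier (TL m N2); x \<in> carrier M1; y \<in> carrier M2\<rbrakk> \<Longrightarrow>
      \<beta> (a \<otimes>\<^bsub>TL m K\<^esub> TL_shift m N1 N2 K b) x y = \<beta> a x (b \<odot>\<^bsub>M2\<^esub> y)"
  using assms(1) unfolding fusion_balanced_def assms(2)[symmetric] by auto

context fusion_pair
begin

abbreviation "K \<equiv> N1 + N2"
abbreviation "Fus \<equiv> fusion m N1 N2 M1 M2"
abbreviation "fp \<equiv> fusion_pure m N1 N2 M1 M2"
abbreviation "ft \<equiv> fusion_tensor m N1 N2 M1 M2"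

lemma shift1_hom: "TL_shift m 0 N1 K \<in> ring_hom (TL m N1) (TL m K)"
  by (rule TL_shift_hom) simp

lemma shift2_hom: "TL_shift m N1 N2 K \<in> ring_hom (TL m N2) (TL m K)"
  by (rule TL_shift_hom) simp

lemmas shift_closed = ring_hom_closed[OF shift1_hom] ring_hom_closed[OF shift2_hom]

abbreviation "diagonal_lift a b \<equiv> tensor_lift ct (\<lambda>x y. cp (a \<odot>\<^bsub>M1\<^esub> x) (b \<odot>\<^bsub>M2\<^esub> y))"

lemma diagonal_lift:
  assumes a: "a \<in> carrier (TL m N1)" and b: "b \<in> carrier (TL m N2)"
  shows diagonal_lift_additive: "additive_map ct ct (diagonal_lift a b)"
    and diagonal_lift_pure: "\<And>x y. \<lbrakk>x \<in> carrier M1; y \<in> carrier M2\<rbrakk> \<Longrightarrow>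
      diagonal_lift a b (cp x y) = cp (a \<odot>\<^bsub>M1\<^esub> x) (b \<odot>\<^bsub>M2\<^esub> y)"
proof -
  have lift: "abelian_group ct"
    "\<And>x. x \<in> carrier M1 \<Longrightarrow> additive_map M2 ct (\<lambda>y. cp (a \<odot>\<^bsub>M1\<^esub> x) (b \<odot>\<^bsub>M2\<^esub> y))"
    "\<And>y. y \<in> carrier M2 \<Longrightarrow> additive_map M1 ct (\<lambda>x. cp (a \<odot>\<^bsub>M1\<^esub> x) (b \<odot>\<^bsub>M2\<^esub> y))"
    "\<And>x y c. \<lbrakk>x \<in> carrier M1; y \<in> carrier M2\<rbrakk> \<Longrightarrow>
      cp (a \<odot>\<^bsub>M1\<^esub> cscale m N1 M1 c x) (b \<odot>\<^bsub>M2\<^esub> y) = cp (a \<odot>\<^bsub>M1\<^esub> x) (b \<odot>\<^bsub>M2\<^esub> cscale m N2 M2 c y)"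
  proof -
    show "x \<in> carrier M1 \<Longrightarrow> additive_map M2 ct (\<lambda>y. cp (a \<odot>\<^bsub>M1\<^esub> x) (b \<odot>\<^bsub>M2\<^esub> y))" for x
      by (rule additive_compose[OF left_module_additive_right[OF left_module2 b] cpure_additive_right])
        (simp add: smult1_closed a)
    show "y \<in> carrier M2 \<Longrightarrow> additive_map M1 ct (\<lambda>x. cp (a \<odot>\<^bsub>M1\<^esub> x) (b \<odot>\<^bsub>M2\<^esub> y))" for y
      by (rule additive_compose[OF left_module_additive_right[OF left_module1 a] cpure_additive_left])
        (simp add: smult2_closed b)
  qed (simp_all add: ctensor_abelian_group smult_cscale[OF left_module1 a] smult_cscale[OF left_module2 b]
      cpure_cscale smult1_closed smult2_closed a b)
  show "additive_map ct ct (diagonal_lift a b)"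
    by (rule ctensor_lift_additive[OF lift])
  show "diagonal_lift a b (cp x y) = cp (a \<odot>\<^bsub>M1\<^esub> x) (b \<odot>\<^bsub>M2\<^esub> y)"
    if "x \<in> carrier M1" "y \<in> carrier M2" for x y
    using ctensor_lift_pure[OF lift that] .
qed

text \<open>
  The action of \<open>a \<otimes> b\<close> on \<open>u\<close> is additive in \<open>a\<close> and in \<open>b\<close> and balanced for each fixed \<open>u\<close>; as these
  are identities between additive maps of \<open>u\<close>, they are checked on \<open>u = x \<otimes> y\<close>.
\<close>

lemma outer_act_properties:
  shows outer_act_additive_left:
      "u \<in> carrier ct \<Longrightarrow> additive_map (regular_tensor m N1 N2) ct (\<lambda>t. outer_act m N1 N2 M1 M2 t u)"
    and outer_act_regular_pure:
      "\<lbrakk>a \<in> carrier (TL m N1); b \<in> carrier (TL m N2); u \<in> carrier ct\<rbrakk> \<Longrightarrow>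
        outer_act m N1 N2 M1 M2 (regular_pure m N1 N2 a b) u = diagonal_lift a b u"
proof -
  interpret P: fusion_pair m N1 N2 "TL_regular m N1" "TL_regular m N2" by (rule regular_fusion_pair)
  interpret R1: ring "TL m N1" by (rule TL_ring)
  interpret R2: ring "TL m N2" by (rule TL_ring)
  have lift: "abelian_group ct"
    "\<And>a. a \<in> carrier (TL_regular m N1) \<Longrightarrow> additive_map (TL_regular m N2) ct (\<lambda>b. diagonal_lift a b u)"
    "\<And>b. b \<in> carrier (TL_regular m N2) \<Longrightarrow> additive_map (TL_regular m N1) ct (\<lambda>a. diagonal_lift a b u)"
    "\<And>a b c. \<lbrakk>a \<in> carrier (TL_regular m N1); b \<in> carrier (TL_regular m N2)\<rbrakk> \<Longrightarrow>
      diagonal_lift (cscale m N1 (TL_regular m N1) c a) b u = diagonal_lift a (cscale m N2 (TL_regular m N2) c b) u"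
    if u: "u \<in> carrier ct" for u
  proof -
    note additive_intros = additive_add_functions[OF ctensor_abelian_group] diagonal_lift_additive
    have add2: "diagonal_lift a (b \<oplus>\<^bsub>TL m N2\<^esub> b') u = diagonal_lift a b u \<oplus>\<^bsub>ct\<^esub> diagonal_lift a b' u"
      if "a \<in> carrier (TL m N1)" "b \<in> carrier (TL m N2)" "b' \<in> carrier (TL m N2)" for a b b'
      by (rule ctensor_ext[OF _ _ _ u])
        (use that in \<open>auto intro!: additive_intros simp: diagonal_lift_pure smult1_closed smult2_closed
          additive_add[OF left_module_additive_left[OF left_module2]] additive_add[OF cpure_additive_right]\<close>)
    have add1: "diagonal_lift (a \<oplus>\<^bsub>TL m N1\<^esub> a') b u = diagonal_lift a b u \<oplus>\<^bsub>ct\<^esub> diagonal_lift a' b u"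
      if "a \<in> carrier (TL m N1)" "a' \<in> carrier (TL m N1)" "b \<in> carrier (TL m N2)" for a a' b
      by (rule ctensor_ext[OF _ _ _ u])
        (use that in \<open>auto intro!: additive_intros simp: diagonal_lift_pure smult1_closed smult2_closed
          additive_add[OF left_module_additive_left[OF left_module1]] additive_add[OF cpure_additive_left]\<close>)
    show "additive_map (TL_regular m N2) ct (\<lambda>b. diagonal_lift a b u)" if "a \<in> carrier (TL_regular m N1)" for a
      by (rule additiveI) (use that u in \<open>simp_all add: add2 additive_closed[OF diagonal_lift_additive]\<close>)
    show "additive_map (TL_regular m N1) ct (\<lambda>a. diagonal_lift a b u)" if "b \<in> carrier (TL_regular m N2)" for b
      by (rule additiveI) (use that u in \<open>simp_all add: add1 additive_closed[OF diagonal_lift_additive]\<close>)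
    show "diagonal_lift (cscale m N1 (TL_regular m N1) c a) b u = diagonal_lift a (cscale m N2 (TL_regular m N2) c b) u"
      if ab: "a \<in> carrier (TL_regular m N1)" "b \<in> carrier (TL_regular m N2)" for a b c
    proof (rule ctensor_ext[OF _ _ _ u])
      let ?c1 = "TL_class m N1 (const c)" and ?c2 = "TL_class m N2 (const c)"
      have c: "?c1 \<in> carrier (TL m N1)" "?c2 \<in> carrier (TL m N2)"
        by (simp_all add: TL_class_closed const_closed)
      show "additive_map ct ct (diagonal_lift (cscale m N1 (TL_regular m N1) c a) b)"
        "additive_map ct ct (diagonal_lift a (cscale m N2 (TL_regular m N2) c b))"
        using ab c by (auto simp: cscale_def intro!: diagonal_lift_additive)
      fix x y assume xy: "x \<in> carrier M1" "y \<in> carrier M2"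
      have "cp ((?c1 \<otimes>\<^bsub>TL m N1\<^esub> a) \<odot>\<^bsub>M1\<^esub> x) (b \<odot>\<^bsub>M2\<^esub> y) = cp (cscale m N1 M1 c (a \<odot>\<^bsub>M1\<^esub> x)) (b \<odot>\<^bsub>M2\<^esub> y)"
        using ab c xy by (simp add: cscale_def left_module.smult_assoc[OF left_module1])
      also have "\<dots> = cp (a \<odot>\<^bsub>M1\<^esub> x) (cscale m N2 M2 c (b \<odot>\<^bsub>M2\<^esub> y))"
        using ab xy by (simp add: cpure_cscale smult1_closed smult2_closed)
      also have "\<dots> = cp (a \<odot>\<^bsub>M1\<^esub> x) ((?c2 \<otimes>\<^bsub>TL m N2\<^esub> b) \<odot>\<^bsub>M2\<^esub> y)"
        using ab c xy by (simp add: cscale_def left_module.smult_assoc[OF left_module2])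
      finally show "diagonal_lift (cscale m N1 (TL_regular m N1) c a) b (cp x y) =
          diagonal_lift a (cscale m N2 (TL_regular m N2) c b) (cp x y)"
        using ab c xy by (simp add: diagonal_lift_pure cscale_def)
    qed
  qed (rule ctensor_abelian_group)
  show "additive_map (regular_tensor m N1 N2) ct (\<lambda>t. outer_act m N1 N2 M1 M2 t u)" if "u \<in> carrier ct"
    unfolding outer_act_def by (rule P.ctensor_lift_additive[OF lift[OF that]])
  show "outer_act m N1 N2 M1 M2 (regular_pure m N1 N2 a b) u = diagonal_lift a b u"
    if "a \<in> carrier (TL m N1)" "b \<in> carrier (TL m N2)" "u \<in> carrier ct"
    unfolding outer_act_def by (rule P.ctensor_lift_pure[OF lift[OF that(3)]]) (use that in simp_all)
qed

lemma outer_act_closed: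
  "\<lbrakk>t \<in> carrier (regular_tensor m N1 N2); u \<in> carrier ct\<rbrakk> \<Longrightarrow> outer_act m N1 N2 M1 M2 t u \<in> carrier ct"
  by (rule additive_closed[OF outer_act_additive_left])

lemma outer_act_pure:
  "\<lbrakk>a \<in> carrier (TL m N1); b \<in> carrier (TL m N2); x \<in> carrier M1; y \<in> carrier M2\<rbrakk> \<Longrightarrow>
    outer_act m N1 N2 M1 M2 (regular_pure m N1 N2 a b) (cp x y) = cp (a \<odot>\<^bsub>M1\<^esub> x) (b \<odot>\<^bsub>M2\<^esub> y)"
  by (simp add: outer_act_regular_pure cpure_closed diagonal_lift_pure)

lemma outer_tensor_simps [simp]:
  "carrier (outer_tensor m N1 N2 M1 M2) = carrier ct"
  "t \<odot>\<^bsub>outer_tensor m N1 N2 M1 M2\<^esub> u = outer_act m N1 N2 M1 M2 t u"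
  "additive_map (outer_tensor m N1 N2 M1 M2) Z f \<longleftrightarrow> additive_map ct Z f"
  by (simp_all add: outer_tensor_def)

lemma fusion_factors:
  "tensor_factors (TL_tensor m N1 N2) (\<lambda>a t. a \<otimes>\<^bsub>TL m K\<^esub> TL_incl m N1 N2 t) (TL m K) (outer_tensor m N1 N2 M1 M2)"
proof (intro tensor_factors.intro tensor_factors_axioms.intro TL_abelian_group)
  interpret K: ring "TL m K" by (rule TL_ring)
  show "abelian_group (outer_tensor m N1 N2 M1 M2)"
    unfolding outer_tensor_def by (rule with_smult_abelian_group[OF ctensor_abelian_group])
  show "a \<otimes>\<^bsub>TL m K\<^esub> TL_incl m N1 N2 t \<in> carrier (TL m K)"
    if "a \<in> carrier (TL m K)" "t \<in> carrier (TL_tensor m N1 N2)" for a t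
    using that additive_closed[OF TL_incl_additive] by simp
qed (simp add: outer_act_closed)

lemma fusion_simps:
  "carrier Fus = carrier (fusion_group m N1 N2 M1 M2)"
  "additive_map Fus Z f \<longleftrightarrow> additive_map (fusion_group m N1 N2 M1 M2) Z f"
  "additive_map G Fus f' \<longleftrightarrow> additive_map G (fusion_group m N1 N2 M1 M2) f'"
  by (simp_all add: fusion_def)

lemma fusion_abelian_group: "abelian_group Fus"
  unfolding fusion_def fusion_group_def
  by (rule with_smult_abelian_group[OF tensor_factors.tensor_abelian_group[OF fusion_factors]])

lemma fusion_pure_closed: "\<lbrakk>a \<in> carrier (TL m K); u \<in> carrier ct\<rbrakk> \<Longrightarrow> fp a u \<in> carrier Fus"
  unfolding fusion_simps fusion_group_def fusion_pure_def
  using tensor_factors.pure_closed[OF fusion_factors] by simp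

lemma fusion_pure_additive:
  shows fusion_pure_additive_left: "u \<in> carrier ct \<Longrightarrow> additive_map (TL m K) Fus (\<lambda>a. fp a u)"
    and fusion_pure_additive_right: "a \<in> carrier (TL m K) \<Longrightarrow> additive_map ct Fus (fp a)"
  using tensor_factors.pure_balanced_map[OF fusion_factors]
  unfolding fusion_simps fusion_group_def fusion_pure_def balanced_map_def by simp_all

lemma fusion_pure_balanced:
  "\<lbrakk>a \<in> carrier (TL m K); t \<in> carrier (regular_tensor m N1 N2); u \<in> carrier ct\<rbrakk> \<Longrightarrow>
    fp (a \<otimes>\<^bsub>TL m K\<^esub> TL_incl m N1 N2 t) u = fp a (outer_act m N1 N2 M1 M2 t u)"
  unfolding fusion_pure_def using tensor_factors.pure_balanced[OF fusion_factors] by simp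

lemma fusion_pure_ext:
  assumes "additive_map Fus Z f" "additive_map Fus Z g"
    and "\<And>a u. \<lbrakk>a \<in> carrier (TL m K); u \<in> carrier ct\<rbrakk> \<Longrightarrow> f (fp a u) = g (fp a u)"
    and "v \<in> carrier Fus"
  shows "f v = g v"
  using tensor_factors.tensor_additive_ext[OF fusion_factors, of Z f g v] assms
  unfolding fusion_simps fusion_group_def fusion_pure_def by simp

lemma regular_tensor_one_left:
  assumes "b \<in> carrier (TL m N2)"
  shows "TL_incl m N1 N2 (regular_pure m N1 N2 \<one>\<^bsub>TL m N1\<^esub> b) = TL_shift m N1 N2 K b"
proof -
  interpret K: ring "TL m K" by (rule TL_ring)
  interpret R1: ring "TL m N1" by (rule TL_ring)
  show ?thesis
    using assms by (simp add: TL_incl_pure ring_hom_one[OF shift1_hom] shift_closed)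
qed

lemma regular_tensor_one_right:
  assumes "b \<in> carrier (TL m N1)"
  shows "TL_incl m N1 N2 (regular_pure m N1 N2 b \<one>\<^bsub>TL m N2\<^esub>) = TL_shift m 0 N1 K b"
proof -
  interpret K: ring "TL m K" by (rule TL_ring)
  interpret R2: ring "TL m N2" by (rule TL_ring)
  show ?thesis
    using assms by (simp add: TL_incl_pure ring_hom_one[OF shift2_hom] shift_closed)
qed

lemma fusion_tensor_closed:
  "\<lbrakk>a \<in> carrier (TL m K); x \<in> carrier M1; y \<in> carrier M2\<rbrakk> \<Longrightarrow> ft a x y \<in> carrier Fus"
  unfolding fusion_tensor_def by (intro fusion_pure_closed cpure_closed)

text \<open>
  The two module laws come from balancing with the elements \<open>b \<otimes> 1\<close> and \<open>1 \<otimes> b\<close>.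
\<close>

lemma fusion_tensor_balanced: "fusion_balanced m N1 N2 M1 M2 Fus ft"
proof (rule fusion_balancedI[OF refl])
  interpret P: fusion_pair m N1 N2 "TL_regular m N1" "TL_regular m N2" by (rule regular_fusion_pair)
  interpret R1: ring "TL m N1" by (rule TL_ring)
  interpret R2: ring "TL m N2" by (rule TL_ring)
  show "additive_map (TL m K) Fus (\<lambda>a. ft a x y)" if "x \<in> carrier M1" "y \<in> carrier M2" for x y
    unfolding fusion_tensor_def by (rule fusion_pure_additive_left[OF cpure_closed[OF that]])
  show "additive_map M1 Fus (\<lambda>x. ft a x y)" if "a \<in> carrier (TL m K)" "y \<in> carrier M2" for a y
    unfolding fusion_tensor_def
    by (rule additive_compose[OF cpure_additive_left[OF that(2)] fusion_pure_additive_right[OF that(1)]])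
  show "additive_map M2 Fus (\<lambda>y. ft a x y)" if "a \<in> carrier (TL m K)" "x \<in> carrier M1" for a x
    unfolding fusion_tensor_def
    by (rule additive_compose[OF cpure_additive_right[OF that(2)] fusion_pure_additive_right[OF that(1)]])
  fix a x y assume axy: "a \<in> carrier (TL m K)" "x \<in> carrier M1" "y \<in> carrier M2"
  show "ft (a \<otimes>\<^bsub>TL m K\<^esub> TL_shift m 0 N1 K b) x y = ft a (b \<odot>\<^bsub>M1\<^esub> x) y"
    if b: "b \<in> carrier (TL m N1)" for b
    using fusion_pure_balanced[OF axy(1) P.cpure_closed cpure_closed, of b "\<one>\<^bsub>TL m N2\<^esub>" x y] axy b
    by (simp add: regular_tensor_one_right outer_act_pure fusion_tensor_def left_module.smult_one[OF left_module2])
  show "ft (a \<otimes>\<^bsub>TL m K\<^esub> TL_shift m N1 N2 K b) x y = ft a x (b \<odot>\<^bsub>M2\<^esub> y)"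
    if b: "b \<in> carrier (TL m N2)" for b
    using fusion_pure_balanced[OF axy(1) P.cpure_closed cpure_closed, of "\<one>\<^bsub>TL m N1\<^esub>" b x y] axy b
    by (simp add: regular_tensor_one_left outer_act_pure fusion_tensor_def left_module.smult_one[OF left_module1])
qed

lemma fusion_ext:
  assumes f: "additive_map Fus Z f" and g: "additive_map Fus Z g"
    and eq: "\<And>a x y. \<lbrakk>a \<in> carrier (TL m K); x \<in> carrier M1; y \<in> carrier M2\<rbrakk> \<Longrightarrow> f (ft a x y) = g (ft a x y)"
    and v: "v \<in> carrier Fus"
  shows "f v = g v"
proof (rule fusion_pure_ext[OF f g _ v])
  fix a u assume a: "a \<in> carrier (TL m K)" and u: "u \<in> carrier ct"
  show "f (fp a u) = g (fp a u)"
    by (rule ctensor_ext[OF additive_compose[OF fusion_pure_additive_right[OF a] f]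
          additive_compose[OF fusion_pure_additive_right[OF a] g] _ u])
      (simp add: eq a fusion_tensor_def[symmetric])
qed

text \<open>
  A complex scalar \<open>c\<close> moves from \<open>x\<close> to the coefficient \<open>a\<close> as an element of \<open>TL\<^bsub>N1\<^esub>\<close>, and from there
  to \<open>y\<close> as an element of \<open>TL\<^bsub>N2\<^esub>\<close>; hence \<open>\<beta> a\<close> factors through the tensor product over \<open>\<complex>\<close>.
\<close>

lemma fusion_lift_inner:
  assumes Z: "abelian_group Z" and \<beta>: "fusion_balanced m N1 N2 M1 M2 Z \<beta>" and a: "a \<in> carrier (TL m K)"
  shows fusion_lift_inner_additive: "additive_map ct Z (tensor_lift Z (\<beta> a))"
    and fusion_lift_inner_pure:
      "\<And>x y. \<lbrakk>x \<in> carrier M1; y \<in> carrier M2\<rbrakk> \<Longrightarrow> tensor_lift Z (\<beta> a) (cp x y) = \<beta> a x y"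
proof -
  note \<beta>D = fusion_balancedD[OF \<beta> refl]
  have bal: "\<beta> a (cscale m N1 M1 c x) y = \<beta> a x (cscale m N2 M2 c y)"
    if xy: "x \<in> carrier M1" "y \<in> carrier M2" for x y c
  proof -
    have "\<beta> a (cscale m N1 M1 c x) y = \<beta> (a \<otimes>\<^bsub>TL m K\<^esub> TL_class m K (const c)) x y"
      using \<beta>D(4)[OF a TL_class_closed[OF const_closed] xy] by (simp add: cscale_def TL_shift_const)
    also have "\<dots> = \<beta> a x (cscale m N2 M2 c y)"
      using \<beta>D(5)[OF a TL_class_closed[OF const_closed] xy] by (simp add: cscale_def TL_shift_const)
    finally show ?thesis .
  qed
  note lift = Z \<beta>D(3)[OF a] \<beta>D(2)[OF a] bal
  show "additive_map ct Z (tensor_lift Z (\<beta> a))"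
    by (rule ctensor_lift_additive[OF lift])
  show "tensor_lift Z (\<beta> a) (cp x y) = \<beta> a x y" if "x \<in> carrier M1" "y \<in> carrier M2" for x y
    by (rule ctensor_lift_pure[OF lift that])
qed

text \<open>
  Balancedness over \<open>TL\<^bsub>N1\<^esub> \<otimes> TL\<^bsub>N2\<^esub>\<close> is additive in the algebra element, so it reduces to pure tensors
  \<open>b \<otimes> c\<close>, where \<open>b\<close> and \<open>c\<close> are moved one after the other.
\<close>

lemma fusion_lift_balanced_map:
  assumes Z: "abelian_group Z" and \<beta>: "fusion_balanced m N1 N2 M1 M2 Z \<beta>"
  shows "balanced_map (TL_tensor m N1 N2) (\<lambda>a t. a \<otimes>\<^bsub>TL m K\<^esub> TL_incl m N1 N2 t) (TL m K)
    (outer_tensor m N1 N2 M1 M2) Z (\<lambda>a. tensor_lift Z (\<beta> a))"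
proof (rule balanced_mapI)
  interpret P: fusion_pair m N1 N2 "TL_regular m N1" "TL_regular m N2" by (rule regular_fusion_pair)
  interpret K: ring "TL m K" by (rule TL_ring)
  interpret Z: abelian_group Z by fact
  note \<beta>D = fusion_balancedD[OF \<beta> refl]
  note inner = fusion_lift_inner_additive[OF Z \<beta>]
  note inner_pure = fusion_lift_inner_pure[OF Z \<beta>]
  show "additive_map (outer_tensor m N1 N2 M1 M2) Z (tensor_lift Z (\<beta> a))" if "a \<in> carrier (TL m K)" for a
    using inner[OF that] by simp
  have lift_add: "tensor_lift Z (\<beta> (a \<oplus>\<^bsub>TL m K\<^esub> b)) u = tensor_lift Z (\<beta> a) u \<oplus>\<^bsub>Z\<^esub> tensor_lift Z (\<beta> b) u"
    if "a \<in> carrier (TL m K)" "b \<in> carrier (TL m K)" "u \<in> carrier ct" for a b u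
    by (rule ctensor_ext[where Z = Z, OF _ _ _ that(3)])
      (use that in \<open>simp_all add: inner additive_add_functions[OF Z] inner_pure additive_add[OF \<beta>D(1)]\<close>)
  show "additive_map (TL m K) Z (\<lambda>a. tensor_lift Z (\<beta> a) u)"
    if "u \<in> carrier (outer_tensor m N1 N2 M1 M2)" for u
    by (rule additiveI) (use that in \<open>simp_all add: lift_add additive_closed[OF inner]\<close>)
  fix a t u
  assume a: "a \<in> carrier (TL m K)" and t: "t \<in> carrier (TL_tensor m N1 N2)"
    and u: "u \<in> carrier (outer_tensor m N1 N2 M1 M2)"
  have incl: "TL_incl m N1 N2 t \<in> carrier (TL m K)" if "t \<in> carrier (regular_tensor m N1 N2)" for t
    by (rule additive_closed[OF TL_incl_additive that])
  have "tensor_lift Z (\<beta> (a \<otimes>\<^bsub>TL m K\<^esub> TL_incl m N1 N2 t)) u = tensor_lift Z (\<beta> a) (outer_act m N1 N2 M1 M2 t u)"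
    using t[unfolded carrier_TL_tensor]
  proof (induction t rule: P.ctensor_induct)
    case (pure b c)
    then have bc: "b \<in> carrier (TL m N1)" "c \<in> carrier (TL m N2)" by simp_all
    have pure_t: "regular_pure m N1 N2 b c \<in> carrier (regular_tensor m N1 N2)"
      using pure by (rule P.cpure_closed)
    show ?case
      unfolding outer_act_regular_pure[OF bc u[unfolded outer_tensor_simps]]
    proof (rule ctensor_ext[OF inner additive_compose[OF diagonal_lift_additive[OF bc] inner]])
      show "a \<otimes>\<^bsub>TL m K\<^esub> TL_incl m N1 N2 (regular_pure m N1 N2 b c) \<in> carrier (TL m K)"
        using a pure_t by (simp add: incl)
      show "u \<in> carrier ct" using u by simp
      fix x y assume xy: "x \<in> carrier M1" "y \<in> carrier M2"
      let ?b = "TL_shift m 0 N1 K b" and ?c = "TL_shift m N1 N2 K c"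
      have cl: "?b \<in> carrier (TL m K)" "?c \<in> carrier (TL m K)"
        using bc by (simp_all add: shift_closed)
      have "\<beta> (a \<otimes>\<^bsub>TL m K\<^esub> (?b \<otimes>\<^bsub>TL m K\<^esub> ?c)) x y = \<beta> ((a \<otimes>\<^bsub>TL m K\<^esub> ?b) \<otimes>\<^bsub>TL m K\<^esub> ?c) x y"
        using a cl by (simp add: K.m_assoc)
      also have "\<dots> = \<beta> a (b \<odot>\<^bsub>M1\<^esub> x) (c \<odot>\<^bsub>M2\<^esub> y)"
        using a bc cl xy by (simp add: \<beta>D(4,5) smult1_closed smult2_closed)
      finally show "tensor_lift Z (\<beta> (a \<otimes>\<^bsub>TL m K\<^esub> TL_incl m N1 N2 (regular_pure m N1 N2 b c))) (cp x y) =
          tensor_lift Z (\<beta> a) (diagonal_lift b c (cp x y))"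
        using a bc cl xy by (simp add: TL_incl_pure inner_pure diagonal_lift_pure smult1_closed smult2_closed)
    qed (rule a)
  next
    case (add t t')
    then show ?case
      using a u
      by (simp add: additive_add[OF TL_incl_additive] additive_add[OF outer_act_additive_left] incl K.r_distr
          lift_add additive_add[OF inner] outer_act_closed)
  qed
  then show "tensor_lift Z (\<beta> (a \<otimes>\<^bsub>TL m K\<^esub> TL_incl m N1 N2 t)) u =
      tensor_lift Z (\<beta> a) (t \<odot>\<^bsub>outer_tensor m N1 N2 M1 M2\<^esub> u)"
    by simp
qed

lemma balanced_map_fusion_lift:
  assumes Z: "abelian_group Z"
    and \<beta>: "balanced_map (TL_tensor m N1 N2) (\<lambda>a t. a \<otimes>\<^bsub>TL m K\<^esub> TL_incl m N1 N2 t) (TL m K)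
      (outer_tensor m N1 N2 M1 M2) Z \<beta>"
  shows "additive_map Fus Z (tensor_lift Z \<beta>)"
    and "\<lbrakk>a \<in> carrier (TL m K); u \<in> carrier ct\<rbrakk> \<Longrightarrow> tensor_lift Z \<beta> (fp a u) = \<beta> a u"
  using tensor_factors.tensor_lift_additive[OF fusion_factors Z \<beta>]
    tensor_factors.tensor_lift_pure[OF fusion_factors Z \<beta>, of a u]
  unfolding fusion_simps fusion_group_def fusion_pure_def by simp_all

text \<open>
  The universal property of the fusion; \<open>fusion_ext\<close> is its uniqueness part.
\<close>

lemma fusion_lift:
  assumes Z: "abelian_group Z" and \<beta>: "fusion_balanced m N1 N2 M1 M2 Z \<beta>"
  shows fusion_lift_additive: "additive_map Fus Z (tensor_lift Z (\<lambda>a. tensor_lift Z (\<beta> a)))"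
    and fusion_lift_tensor: "\<And>a x y. \<lbrakk>a \<in> carrier (TL m K); x \<in> carrier M1; y \<in> carrier M2\<rbrakk> \<Longrightarrow>
      tensor_lift Z (\<lambda>a. tensor_lift Z (\<beta> a)) (ft a x y) = \<beta> a x y"
  using balanced_map_fusion_lift[OF Z fusion_lift_balanced_map[OF Z \<beta>]]
  by (simp_all add: fusion_tensor_def cpure_closed fusion_lift_inner_pure[OF Z \<beta>])

lemma fusion_smult_properties:
  assumes s: "s \<in> carrier (TL m K)"
  shows fusion_smult_additive: "additive_map Fus Fus (\<lambda>v. s \<odot>\<^bsub>Fus\<^esub> v)"
    and fusion_smult_tensor: "\<And>a x y. \<lbrakk>a \<in> carrier (TL m K); x \<in> carrier M1; y \<in> carrier M2\<rbrakk> \<Longrightarrow>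
      s \<odot>\<^bsub>Fus\<^esub> ft a x y = ft (s \<otimes>\<^bsub>TL m K\<^esub> a) x y"
proof -
  interpret K: ring "TL m K" by (rule TL_ring)
  let ?G = "fusion_group m N1 N2 M1 M2"
  have G: "abelian_group ?G"
    unfolding fusion_group_def by (rule tensor_factors.tensor_abelian_group[OF fusion_factors])
  have "additive_map (TL m K) ?G (\<lambda>a. fp (s \<otimes>\<^bsub>TL m K\<^esub> a) u)" if "u \<in> carrier ct" for u
    by (rule additive_compose[OF additiveI fusion_pure_additive_left[OF that, unfolded fusion_simps]])
      (use s in \<open>simp_all add: K.r_distr\<close>)
  then have bal: "balanced_map (TL_tensor m N1 N2) (\<lambda>a t. a \<otimes>\<^bsub>TL m K\<^esub> TL_incl m N1 N2 t) (TL m K)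
      (outer_tensor m N1 N2 M1 M2) ?G (\<lambda>a u. fp (s \<otimes>\<^bsub>TL m K\<^esub> a) u)"
    using s additive_closed[OF TL_incl_additive]
    by (intro balanced_mapI)
      (simp_all add: fusion_pure_additive_right[unfolded fusion_simps] K.m_assoc[symmetric] fusion_pure_balanced)
  have smult: "s \<odot>\<^bsub>Fus\<^esub> v = tensor_lift ?G (\<lambda>a u. fp (s \<otimes>\<^bsub>TL m K\<^esub> a) u) v" for v
    by (simp add: fusion_def)
  show "additive_map Fus Fus (\<lambda>v. s \<odot>\<^bsub>Fus\<^esub> v)"
    unfolding smult fusion_simps(3) by (rule balanced_map_fusion_lift[OF G bal])
  show "s \<odot>\<^bsub>Fus\<^esub> ft a x y = ft (s \<otimes>\<^bsub>TL m K\<^esub> a) x y"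
    if "a \<in> carrier (TL m K)" "x \<in> carrier M1" "y \<in> carrier M2" for a x y
    unfolding smult fusion_tensor_def
    using balanced_map_fusion_lift(2)[OF G bal] that by (simp add: cpure_closed)
qed

lemma fusion_left_module: "left_module (TL m K) Fus"
proof (intro left_module.intro left_module_axioms.intro TL_ring fusion_abelian_group)
  interpret K: ring "TL m K" by (rule TL_ring)
  note ftD = fusion_balancedD[OF fusion_tensor_balanced refl]
  show smult_closed: "a \<odot>\<^bsub>Fus\<^esub> v \<in> carrier Fus" if "a \<in> carrier (TL m K)" "v \<in> carrier Fus" for a v
    by (rule additive_closed[OF fusion_smult_additive[OF that(1)] that(2)])
  show "a \<odot>\<^bsub>Fus\<^esub> (v \<oplus>\<^bsub>Fus\<^esub> w) = a \<odot>\<^bsub>Fus\<^esub> v \<oplus>\<^bsub>Fus\<^esub> a \<odot>\<^bsub>Fus\<^esub> w"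
    if "a \<in> carrier (TL m K)" "v \<in> carrier Fus" "w \<in> carrier Fus" for a v w
    by (rule additive_add[OF fusion_smult_additive[OF that(1)] that(2,3)])
  show "(a \<oplus>\<^bsub>TL m K\<^esub> b) \<odot>\<^bsub>Fus\<^esub> v = a \<odot>\<^bsub>Fus\<^esub> v \<oplus>\<^bsub>Fus\<^esub> b \<odot>\<^bsub>Fus\<^esub> v"
    if ab: "a \<in> carrier (TL m K)" "b \<in> carrier (TL m K)" "v \<in> carrier Fus" for a b v
    by (rule fusion_ext[OF fusion_smult_additive
          additive_add_functions[OF fusion_abelian_group fusion_smult_additive fusion_smult_additive] _ ab(3)])
      (use ab in \<open>simp_all add: fusion_smult_tensor K.l_distr additive_add[OF ftD(1)]\<close>)
  show "(a \<otimes>\<^bsub>TL m K\<^esub> b) \<odot>\<^bsub>Fus\<^esub> v = a \<odot>\<^bsub>Fus\<^esub> (b \<odot>\<^bsub>Fus\<^esub> v)"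
    if ab: "a \<in> carrier (TL m K)" "b \<in> carrier (TL m K)" "v \<in> carrier Fus" for a b v
    by (rule fusion_ext[OF fusion_smult_additive
          additive_compose[OF fusion_smult_additive fusion_smult_additive] _ ab(3)])
      (use ab in \<open>simp_all add: fusion_smult_tensor K.m_assoc\<close>)
  show "\<one>\<^bsub>TL m K\<^esub> \<odot>\<^bsub>Fus\<^esub> v = v" if "v \<in> carrier Fus" for v
    by (rule fusion_ext[OF fusion_smult_additive additive_id _ that]) (simp_all add: fusion_smult_tensor)
qed

end

section \<open>Fusion of morphisms\<close>

lemma left_module_hom_additive: "f \<in> left_module_hom R M N \<Longrightarrow> additive_map M N f"
  by (auto simp: left_module_hom_def additive_map_def)

lemma left_module_hom_smult:
  "\<lbrakk>f \<in> left_module_hom R M N; r \<in> carrier R; x \<in> carrier M\<rbrakk> \<Longrightarrow> f (r \<odot>\<^bsub>M\<^esub> x) = r \<odot>\<^bsub>N\<^esub> f x"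
  by (simp add: left_module_hom_def)

text \<open>
  \<^const>\<open>fusion_map\<close> first lifts to the tensor product over \<open>\<complex>\<close> and then applies
  \<^const>\<open>fusion_pure\<close>, which is not literally the form covered by \<open>fusion_lift\<close>.  The two forms
  agree on the arguments that matter, which suffices by \<open>balanced_map_cong\<close>.
\<close>

lemma fusion_map_properties:
  assumes M: "fusion_pair m N1 N2 M1 M2" and M': "fusion_pair m N1 N2 M1' M2'"
    and f: "f \<in> left_module_hom (TL m N1) M1 M1'" and g: "g \<in> left_module_hom (TL m N2) M2 M2'"
  shows fusion_map_additive:
      "additive_map (fusion m N1 N2 M1 M2) (fusion m N1 N2 M1' M2') (fusion_map m N1 N2 M1' M2' f g)"
    and fusion_map_tensor:
      "\<lbrakk>a \<in> carrier (TL m (N1 + N2)); x \<in> carrier M1; y \<in> carrier M2\<rbrakk> \<Longrightarrow>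
        fusion_map m N1 N2 M1' M2' f g (fusion_tensor m N1 N2 M1 M2 a x y) =
        fusion_tensor m N1 N2 M1' M2' a (f x) (g y)"
proof -
  interpret M: fusion_pair m N1 N2 M1 M2 by fact
  interpret M': fusion_pair m N1 N2 M1' M2' by fact
  let ?Z = "fusion m N1 N2 M1' M2'"
  let ?F = "tensor_lift (ctensor m N1 N2 M1' M2') (\<lambda>x y. cpure m N1 N2 M1' M2' (f x) (g y))"
  let ?\<beta> = "\<lambda>a x y. fusion_tensor m N1 N2 M1' M2' a (f x) (g y)"
  note fa = left_module_hom_additive[OF f] and ga = left_module_hom_additive[OF g]
  note fg = additive_closed[OF fa] additive_closed[OF ga] left_module_hom_smult[OF f] left_module_hom_smult[OF g]
  note ftD = fusion_balancedD[OF M'.fusion_tensor_balanced refl]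
  have \<beta>: "fusion_balanced m N1 N2 M1 M2 ?Z ?\<beta>"
    by (rule fusion_balancedI[OF refl])
      (simp_all add: fg ftD additive_compose[OF fa ftD(2)] additive_compose[OF ga ftD(3)])
  have f_cscale: "f (cscale m N1 M1 c x) = cscale m N1 M1' c (f x)" if "x \<in> carrier M1" for c x
    using that by (simp add: cscale_def fg TL_class_closed const_closed)
  have g_cscale: "g (cscale m N2 M2 c y) = cscale m N2 M2' c (g y)" if "y \<in> carrier M2" for c y
    using that by (simp add: cscale_def fg TL_class_closed const_closed)
  have lift: "abelian_group (ctensor m N1 N2 M1' M2')"
    "\<And>x. x \<in> carrier M1 \<Longrightarrow> additive_map M2 (ctensor m N1 N2 M1' M2') (\<lambda>y. cpure m N1 N2 M1' M2' (f x) (g y))"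
    "\<And>y. y \<in> carrier M2 \<Longrightarrow> additive_map M1 (ctensor m N1 N2 M1' M2') (\<lambda>x. cpure m N1 N2 M1' M2' (f x) (g y))"
    "\<And>x y c. \<lbrakk>x \<in> carrier M1; y \<in> carrier M2\<rbrakk> \<Longrightarrow>
      cpure m N1 N2 M1' M2' (f (cscale m N1 M1 c x)) (g y) = cpure m N1 N2 M1' M2' (f x) (g (cscale m N2 M2 c y))"
    by (simp_all add: M'.ctensor_abelian_group fg f_cscale g_cscale M'.cpure_cscale
        additive_compose[OF fa M'.cpure_additive_left] additive_compose[OF ga M'.cpure_additive_right])
  have F_additive: "additive_map (ctensor m N1 N2 M1 M2) (ctensor m N1 N2 M1' M2') ?F"
    by (rule M.ctensor_lift_additive[OF lift])
  have F_pure: "?F (cpure m N1 N2 M1 M2 x y) = cpure m N1 N2 M1' M2' (f x) (g y)"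
    if "x \<in> carrier M1" "y \<in> carrier M2" for x y
    by (rule M.ctensor_lift_pure[OF lift that])
  have eq: "fusion_pure m N1 N2 M1' M2' a (?F u) = tensor_lift ?Z (?\<beta> a) u"
    if a: "a \<in> carrier (TL m (N1 + N2))" and u: "u \<in> carrier (ctensor m N1 N2 M1 M2)" for a u
  proof (rule M.ctensor_ext[where Z = ?Z, OF _ _ _ u])
    show "additive_map (ctensor m N1 N2 M1 M2) ?Z (\<lambda>u. fusion_pure m N1 N2 M1' M2' a (?F u))"
      by (rule additive_compose[OF F_additive M'.fusion_pure_additive_right[OF a]])
    show "additive_map (ctensor m N1 N2 M1 M2) ?Z (tensor_lift ?Z (?\<beta> a))"
      by (rule M.fusion_lift_inner_additive[OF M'.fusion_abelian_group \<beta> a])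
    fix x y assume xy: "x \<in> carrier M1" "y \<in> carrier M2"
    show "fusion_pure m N1 N2 M1' M2' a (?F (cpure m N1 N2 M1 M2 x y)) =
        tensor_lift ?Z (?\<beta> a) (cpure m N1 N2 M1 M2 x y)"
      unfolding F_pure[OF xy] M.fusion_lift_inner_pure[OF M'.fusion_abelian_group \<beta> a xy]
      by (simp add: fusion_tensor_def)
  qed
  have bal: "balanced_map (TL_tensor m N1 N2) (\<lambda>a t. a \<otimes>\<^bsub>TL m (N1 + N2)\<^esub> TL_incl m N1 N2 t) (TL m (N1 + N2))
    (outer_tensor m N1 N2 M1 M2) ?Z (\<lambda>a u. fusion_pure m N1 N2 M1' M2' a (?F u))"
    by (rule tensor_factors.balanced_map_cong[OF M.fusion_factors _
          M.fusion_lift_balanced_map[OF M'.fusion_abelian_group \<beta>]]) (simp add: eq)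
  show "additive_map (fusion m N1 N2 M1 M2) ?Z (fusion_map m N1 N2 M1' M2' f g)"
    unfolding fusion_map_def by (rule M.balanced_map_fusion_lift(1)[OF M'.fusion_abelian_group bal])
  show "fusion_map m N1 N2 M1' M2' f g (fusion_tensor m N1 N2 M1 M2 a x y) = ?\<beta> a x y"
    if "a \<in> carrier (TL m (N1 + N2))" "x \<in> carrier M1" "y \<in> carrier M2"
    using M.balanced_map_fusion_lift(2)[OF M'.fusion_abelian_group bal that(1) M.cpure_closed[OF that(2,3)]] that
    by (simp add: fusion_map_def F_pure fusion_tensor_def)
qed

section \<open>The associator and its inverse\<close>

locale fusion_triple =
  fixes m :: complex and N1 N2 N3 :: nat
    and M1 :: "(tl, 'x) module" and M2 :: "(tl, 'y) module" and M3 :: "(tl, 'z) module"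
  assumes left_module1: "left_module (TL m N1) M1" and left_module2: "left_module (TL m N2) M2"
    and left_module3: "left_module (TL m N3) M3"
begin

abbreviation "A \<equiv> TL m (N1 + N2 + N3)"
abbreviation "F12 \<equiv> fusion m N1 N2 M1 M2"
abbreviation "F23 \<equiv> fusion m N2 N3 M2 M3"
abbreviation "L \<equiv> fusion m (N1 + N2) N3 F12 M3"
abbreviation "Rt \<equiv> fusion m N1 (N2 + N3) M1 F23"
abbreviation "t12 \<equiv> fusion_tensor m N1 N2 M1 M2"
abbreviation "t23 \<equiv> fusion_tensor m N2 N3 M2 M3"
abbreviation "tL \<equiv> fusion_tensor m (N1 + N2) N3 F12 M3"
abbreviation "tR \<equiv> fusion_tensor m N1 (N2 + N3) M1 F23"
text \<open>
  The inclusions of \<open>TL\<^bsub>N1+N2\<^esub>\<close> and \<open>TL\<^bsub>N2+N3\<^esub>\<close> into \<open>TL\<^bsub>N1+N2+N3\<^esub>\<close>, on the first and on the last strands.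
\<close>

abbreviation "emb \<equiv> TL_embed m (N1 + N2) (N1 + N2 + N3)"
abbreviation "emb' \<equiv> TL_shift m N1 (N2 + N3) (N1 + N2 + N3)"
abbreviation "one12 \<equiv> \<one>\<^bsub>TL m (N1 + N2)\<^esub>"
abbreviation "one23 \<equiv> \<one>\<^bsub>TL m (N2 + N3)\<^esub>"

lemma sum_assoc: "N1 + (N2 + N3) = N1 + N2 + N3"
  by simp

sublocale P12: fusion_pair m N1 N2 M1 M2
  by (rule fusion_pair.intro[OF left_module1 left_module2])

sublocale P23: fusion_pair m N2 N3 M2 M3
  by (rule fusion_pair.intro[OF left_module2 left_module3])

sublocale PL: fusion_pair m "N1 + N2" N3 F12 M3
  by (rule fusion_pair.intro[OF P12.fusion_left_module left_module3])

sublocale PR: fusion_pair m N1 "N2 + N3" M1 F23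
  by (rule fusion_pair.intro[OF left_module1 P23.fusion_left_module])

sublocale A: ring A
  by (rule TL_ring)

lemma emb_hom: "emb \<in> ring_hom (TL m (N1 + N2)) A" and emb'_hom: "emb' \<in> ring_hom (TL m (N2 + N3)) A"
  by (rule TL_shift_hom; simp)+

lemmas emb_simps = ring_hom_closed[OF emb_hom] ring_hom_closed[OF emb'_hom]
  ring_hom_mult[OF emb_hom] ring_hom_mult[OF emb'_hom] ring_hom_one[OF emb_hom] ring_hom_one[OF emb'_hom]
  ring_hom_add[OF emb_hom] ring_hom_add[OF emb'_hom]

lemma one_closed12: "one12 \<in> carrier (TL m (N1 + N2))" and one_closed23: "one23 \<in> carrier (TL m (N2 + N3))"
  by (rule ring.ring_simprules(6)[OF TL_ring])+

lemma mult_additive: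
  "a \<in> carrier A \<Longrightarrow> additive_map A A (\<lambda>b. a \<otimes>\<^bsub>A\<^esub> b)"
  by (rule additiveI) (simp_all add: A.r_distr)

lemma emb_additive: "additive_map (TL m (N1 + N2)) A emb" "additive_map (TL m (N2 + N3)) A emb'"
  by (rule additiveI; simp add: emb_simps)+

lemmas t12_closed = P12.fusion_tensor_closed
lemmas t23_closed = P23.fusion_tensor_closed
lemmas t12D = fusion_balancedD[OF P12.fusion_tensor_balanced refl]
lemmas t23D = fusion_balancedD[OF P23.fusion_tensor_balanced refl]
lemmas tLD = fusion_balancedD[OF PL.fusion_tensor_balanced refl]
lemmas tRD = fusion_balancedD[OF PR.fusion_tensor_balanced sum_assoc]

lemma shifts_closed:
  "b \<in> carrier (TL m N1) \<Longrightarrow> TL_shift m 0 N1 (N1 + N2) b \<in> carrier (TL m (N1 + N2))"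
  "c \<in> carrier (TL m N2) \<Longrightarrow> TL_shift m N1 N2 (N1 + N2) c \<in> carrier (TL m (N1 + N2))"
  "c \<in> carrier (TL m N2) \<Longrightarrow> TL_shift m 0 N2 (N2 + N3) c \<in> carrier (TL m (N2 + N3))"
  "d \<in> carrier (TL m N3) \<Longrightarrow> TL_shift m N2 N3 (N2 + N3) d \<in> carrier (TL m (N2 + N3))"
  "b \<in> carrier (TL m N1) \<Longrightarrow> TL_shift m 0 N1 (N1 + N2 + N3) b \<in> carrier A"
  "d \<in> carrier (TL m N3) \<Longrightarrow> TL_shift m (N1 + N2) N3 (N1 + N2 + N3) d \<in> carrier A"
  by (erule ring_hom_closed[OF TL_shift_hom, rotated]; simp)+

text \<open>
  The three coherences between the embeddings of the single algebras; the middle one says that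
  \<open>TL\<^bsub>N2\<^esub>\<close> has only one image in \<open>TL\<^bsub>N1+N2+N3\<^esub>\<close>.
\<close>

lemma emb_shifts:
  "b \<in> carrier (TL m N1) \<Longrightarrow> emb (TL_shift m 0 N1 (N1 + N2) b) = TL_shift m 0 N1 (N1 + N2 + N3) b"
  "c \<in> carrier (TL m N2) \<Longrightarrow> emb (TL_shift m N1 N2 (N1 + N2) c) = emb' (TL_shift m 0 N2 (N2 + N3) c)"
  "d \<in> carrier (TL m N3) \<Longrightarrow> emb' (TL_shift m N2 N3 (N2 + N3) d) = TL_shift m (N1 + N2) N3 (N1 + N2 + N3) d"
  by (simp_all add: TL_shift_shift)

text \<open>
  For fixed \<open>a\<close> and \<open>z\<close>, elements of \<open>TL\<^bsub>N2\<^esub>\<close> travel from \<open>b\<close> through \<open>TL\<^bsub>N2+N3\<^esub>\<close> and the unit of the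
  inner fusion to \<open>y\<close>.
\<close>

lemma forward_inner_balanced:
  assumes a: "a \<in> carrier A" and z: "z \<in> carrier M3"
  shows "fusion_balanced m N1 N2 M1 M2 Rt (\<lambda>b x y. tR (a \<otimes>\<^bsub>A\<^esub> emb b) x (t23 one23 y z))"
proof (rule fusion_balancedI[OF refl])
  note cl = a z one_closed23 t23_closed emb_simps shifts_closed
  show "additive_map (TL m (N1 + N2)) Rt (\<lambda>b. tR (a \<otimes>\<^bsub>A\<^esub> emb b) x (t23 one23 y z))"
    if "x \<in> carrier M1" "y \<in> carrier M2" for x y
    by (rule additive_compose[OF additive_compose[OF emb_additive(1) mult_additive[OF a]] tRD(1)])
      (use that in \<open>simp_all add: cl\<close>)
  show "additive_map M1 Rt (\<lambda>x. tR (a \<otimes>\<^bsub>A\<^esub> emb b) x (t23 one23 y z))"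
    if "b \<in> carrier (TL m (N1 + N2))" "y \<in> carrier M2" for b y
    by (rule tRD(2)) (use that in \<open>simp_all add: cl\<close>)
  show "additive_map M2 Rt (\<lambda>y. tR (a \<otimes>\<^bsub>A\<^esub> emb b) x (t23 one23 y z))"
    if "b \<in> carrier (TL m (N1 + N2))" "x \<in> carrier M1" for b x
    by (rule additive_compose[OF t23D(2) tRD(3)]) (use that in \<open>simp_all add: cl\<close>)
next
  fix b c x y
  assume b: "b \<in> carrier (TL m (N1 + N2))" and c: "c \<in> carrier (TL m N1)"
    and xy: "x \<in> carrier M1" "y \<in> carrier M2"
  show "tR (a \<otimes>\<^bsub>A\<^esub> emb (b \<otimes>\<^bsub>TL m (N1 + N2)\<^esub> TL_shift m 0 N1 (N1 + N2) c)) x (t23 one23 y z) =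
      tR (a \<otimes>\<^bsub>A\<^esub> emb b) (c \<odot>\<^bsub>M1\<^esub> x) (t23 one23 y z)"
    using a z b c xy tRD(4)[of "a \<otimes>\<^bsub>A\<^esub> emb b" c x "t23 one23 y z"]
    by (simp add: emb_simps shifts_closed emb_shifts A.m_assoc one_closed23 t23_closed)
next
  interpret R23: ring "TL m (N2 + N3)" by (rule TL_ring)
  fix b c x y
  assume b: "b \<in> carrier (TL m (N1 + N2))" and c: "c \<in> carrier (TL m N2)"
    and xy: "x \<in> carrier M1" "y \<in> carrier M2"
  let ?c = "TL_shift m 0 N2 (N2 + N3) c"
  have "?c \<odot>\<^bsub>F23\<^esub> t23 one23 y z = t23 one23 (c \<odot>\<^bsub>M2\<^esub> y) z"
    using z c xy t23D(4)[of one23 c y z] by (simp add: P23.fusion_smult_tensor shifts_closed)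
  then show "tR (a \<otimes>\<^bsub>A\<^esub> emb (b \<otimes>\<^bsub>TL m (N1 + N2)\<^esub> TL_shift m N1 N2 (N1 + N2) c)) x (t23 one23 y z) =
      tR (a \<otimes>\<^bsub>A\<^esub> emb b) x (t23 one23 (c \<odot>\<^bsub>M2\<^esub> y) z)"
    using a z b c xy tRD(5)[of "a \<otimes>\<^bsub>A\<^esub> emb b" ?c x "t23 one23 y z"]
    by (simp add: emb_simps shifts_closed emb_shifts A.m_assoc t23_closed)
qed

abbreviation "fwd a w z \<equiv>
  tensor_lift Rt (\<lambda>b. tensor_lift Rt (\<lambda>x y. tR (a \<otimes>\<^bsub>A\<^esub> emb b) x (t23 one23 y z))) w"

lemma fwd_additive: "\<lbrakk>a \<in> carrier A; z \<in> carrier M3\<rbrakk> \<Longrightarrow> additive_map F12 Rt (\<lambda>w. fwd a w z)"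
  by (rule P12.fusion_lift_additive[OF PR.fusion_abelian_group forward_inner_balanced])

lemma fwd_tensor:
  "\<lbrakk>a \<in> carrier A; z \<in> carrier M3; b \<in> carrier (TL m (N1 + N2)); x \<in> carrier M1; y \<in> carrier M2\<rbrakk> \<Longrightarrow>
    fwd a (t12 b x y) z = tR (a \<otimes>\<^bsub>A\<^esub> emb b) x (t23 one23 y z)"
  by (rule P12.fusion_lift_tensor[OF PR.fusion_abelian_group forward_inner_balanced])

text \<open>
  Apart from additivity in \<open>w\<close>, each condition compares additive maps of \<open>w\<close> in \<open>M\<^sub>1 \<times>\<^sub>f M\<^sub>2\<close>, hence may be checked on
  \<open>w = b \<otimes> x \<otimes> y\<close>.  For \<open>TL\<^bsub>N3\<^esub>\<close> the coefficient has to be commuted past the image of \<open>b\<close>.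
\<close>

lemma forward_balanced: "fusion_balanced m (N1 + N2) N3 F12 M3 Rt fwd"
proof (rule fusion_balancedI[OF refl])
  interpret R12: ring "TL m (N1 + N2)" by (rule TL_ring)
  interpret R23: ring "TL m (N2 + N3)" by (rule TL_ring)
  interpret M3: left_module "TL m N3" M3 by (rule left_module3)
  note ext = P12.fusion_ext[where Z = Rt]
  note sum = additive_add_functions[OF PR.fusion_abelian_group]
  show "additive_map F12 Rt (\<lambda>w. fwd a w z)" if "a \<in> carrier A" "z \<in> carrier M3" for a z
    by (rule fwd_additive[OF that])
  show "additive_map A Rt (\<lambda>a. fwd a w z)" if w: "w \<in> carrier F12" and z: "z \<in> carrier M3" for w z
  proof (rule additiveI)
    fix a a' assume a: "a \<in> carrier A" "a' \<in> carrier A"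
    show "fwd (a \<oplus>\<^bsub>A\<^esub> a') w z = fwd a w z \<oplus>\<^bsub>Rt\<^esub> fwd a' w z"
      by (rule ext[OF fwd_additive sum[OF fwd_additive fwd_additive] _ w])
        (use a z in \<open>simp_all add: fwd_tensor A.l_distr emb_simps t23_closed additive_add[OF tRD(1)]\<close>)
  qed (use that in \<open>simp add: additive_closed[OF fwd_additive]\<close>)
  show "additive_map M3 Rt (\<lambda>z. fwd a w z)" if a: "a \<in> carrier A" and w: "w \<in> carrier F12" for a w
  proof (rule additiveI)
    fix z z' assume z: "z \<in> carrier M3" "z' \<in> carrier M3"
    show "fwd a w (z \<oplus>\<^bsub>M3\<^esub> z') = fwd a w z \<oplus>\<^bsub>Rt\<^esub> fwd a w z'"
      by (rule ext[OF fwd_additive sum[OF fwd_additive fwd_additive] _ w])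
        (use a z in \<open>simp_all add: fwd_tensor emb_simps t23_closed additive_add[OF t23D(3)] additive_add[OF tRD(3)]\<close>)
  qed (use that in \<open>simp add: additive_closed[OF fwd_additive]\<close>)
  fix a w z assume a: "a \<in> carrier A" and w: "w \<in> carrier F12" and z: "z \<in> carrier M3"
  show "fwd (a \<otimes>\<^bsub>A\<^esub> emb c) w z = fwd a (c \<odot>\<^bsub>F12\<^esub> w) z" if c: "c \<in> carrier (TL m (N1 + N2))" for c
    by (rule ext[OF fwd_additive additive_compose[OF P12.fusion_smult_additive fwd_additive] _ w])
      (use a c z in \<open>simp_all add: fwd_tensor P12.fusion_smult_tensor emb_simps A.m_assoc\<close>)
  show "fwd (a \<otimes>\<^bsub>A\<^esub> TL_shift m (N1 + N2) N3 (N1 + N2 + N3) c) w z = fwd a w (c \<odot>\<^bsub>M3\<^esub> z)"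
    if c: "c \<in> carrier (TL m N3)" for c
  proof (rule ext[OF fwd_additive fwd_additive _ w])
    fix b x y assume bxy: "b \<in> carrier (TL m (N1 + N2))" "x \<in> carrier M1" "y \<in> carrier M2"
    let ?c = "TL_shift m (N1 + N2) N3 (N1 + N2 + N3) c" and ?c' = "TL_shift m N2 N3 (N2 + N3) c"
    have "emb b \<otimes>\<^bsub>A\<^esub> ?c = ?c \<otimes>\<^bsub>A\<^esub> emb b"
      by (rule TL_shift_commute) (use bxy c in simp_all)
    then have "tR (a \<otimes>\<^bsub>A\<^esub> ?c \<otimes>\<^bsub>A\<^esub> emb b) x (t23 one23 y z) =
        tR (a \<otimes>\<^bsub>A\<^esub> emb b \<otimes>\<^bsub>A\<^esub> emb' ?c') x (t23 one23 y z)"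
      using a bxy c by (simp add: A.m_assoc emb_simps emb_shifts shifts_closed)
    also have "\<dots> = tR (a \<otimes>\<^bsub>A\<^esub> emb b) x (?c' \<odot>\<^bsub>F23\<^esub> t23 one23 y z)"
      by (rule tRD(5)) (use a bxy c z in \<open>simp_all add: emb_simps shifts_closed t23_closed\<close>)
    also have "?c' \<odot>\<^bsub>F23\<^esub> t23 one23 y z = t23 one23 y (c \<odot>\<^bsub>M3\<^esub> z)"
      using bxy c z t23D(5)[of one23 c y z] by (simp add: P23.fusion_smult_tensor shifts_closed)
    finally show "fwd (a \<otimes>\<^bsub>A\<^esub> ?c) (t12 b x y) z = fwd a (t12 b x y) (c \<odot>\<^bsub>M3\<^esub> z)"
      using a bxy c z by (simp add: fwd_tensor shifts_closed M3.smult_closed)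
  qed (use a c z in \<open>simp_all add: shifts_closed M3.smult_closed\<close>)
qed

abbreviation "assoc \<equiv> associator m N1 N2 N3 M1 M2 M3"

lemma associator_eq: "assoc = tensor_lift Rt (\<lambda>a. tensor_lift Rt (fwd a))"
  by (simp add: associator_def Let_def)

lemma associator_additive: "additive_map L Rt assoc"
  unfolding associator_eq by (rule PL.fusion_lift_additive[OF PR.fusion_abelian_group forward_balanced])

lemma associator_tensor:
  assumes "a \<in> carrier A" "b \<in> carrier (TL m (N1 + N2))" "x \<in> carrier M1" "y \<in> carrier M2" "z \<in> carrier M3"
  shows "assoc (tL a (t12 b x y) z) = tR (a \<otimes>\<^bsub>A\<^esub> emb b) x (t23 one23 y z)"
  unfolding associator_eq
  using PL.fusion_lift_tensor[OF PR.fusion_abelian_group forward_balanced] assms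
  by (simp add: t12_closed fwd_tensor)

lemma backward_inner_balanced:
  assumes a: "a \<in> carrier A" and x: "x \<in> carrier M1"
  shows "fusion_balanced m N2 N3 M2 M3 L (\<lambda>d y z. tL (a \<otimes>\<^bsub>A\<^esub> emb' d) (t12 one12 x y) z)"
proof (rule fusion_balancedI[OF refl])
  note cl = a x one_closed12 t12_closed emb_simps shifts_closed
  show "additive_map (TL m (N2 + N3)) L (\<lambda>d. tL (a \<otimes>\<^bsub>A\<^esub> emb' d) (t12 one12 x y) z)"
    if "y \<in> carrier M2" "z \<in> carrier M3" for y z
    by (rule additive_compose[OF additive_compose[OF emb_additive(2) mult_additive[OF a]] tLD(1)])
      (use that in \<open>simp_all add: cl\<close>)
  show "additive_map M2 L (\<lambda>y. tL (a \<otimes>\<^bsub>A\<^esub> emb' d) (t12 one12 x y) z)"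
    if "d \<in> carrier (TL m (N2 + N3))" "z \<in> carrier M3" for d z
    by (rule additive_compose[OF t12D(3) tLD(2)]) (use that in \<open>simp_all add: cl\<close>)
  show "additive_map M3 L (\<lambda>z. tL (a \<otimes>\<^bsub>A\<^esub> emb' d) (t12 one12 x y) z)"
    if "d \<in> carrier (TL m (N2 + N3))" "y \<in> carrier M2" for d y
    by (rule tLD(3)) (use that in \<open>simp_all add: cl\<close>)
next
  interpret R12: ring "TL m (N1 + N2)" by (rule TL_ring)
  fix d c y z
  assume d: "d \<in> carrier (TL m (N2 + N3))" and c: "c \<in> carrier (TL m N2)"
    and yz: "y \<in> carrier M2" "z \<in> carrier M3"
  let ?c = "TL_shift m N1 N2 (N1 + N2) c"
  have "?c \<odot>\<^bsub>F12\<^esub> t12 one12 x y = t12 one12 x (c \<odot>\<^bsub>M2\<^esub> y)"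
    using x c yz t12D(5)[of one12 c x y] by (simp add: P12.fusion_smult_tensor shifts_closed)
  then show "tL (a \<otimes>\<^bsub>A\<^esub> emb' (d \<otimes>\<^bsub>TL m (N2 + N3)\<^esub> TL_shift m 0 N2 (N2 + N3) c)) (t12 one12 x y) z =
      tL (a \<otimes>\<^bsub>A\<^esub> emb' d) (t12 one12 x (c \<odot>\<^bsub>M2\<^esub> y)) z"
    using a x d c yz tLD(4)[of "a \<otimes>\<^bsub>A\<^esub> emb' d" ?c "t12 one12 x y" z]
    by (simp add: emb_simps shifts_closed emb_shifts A.m_assoc t12_closed)
next
  fix d c y z
  assume d: "d \<in> carrier (TL m (N2 + N3))" and c: "c \<in> carrier (TL m N3)"
    and yz: "y \<in> carrier M2" "z \<in> carrier M3"
  show "tL (a \<otimes>\<^bsub>A\<^esub> emb' (d \<otimes>\<^bsub>TL m (N2 + N3)\<^esub> TL_shift m N2 N3 (N2 + N3) c)) (t12 one12 x y) z =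
      tL (a \<otimes>\<^bsub>A\<^esub> emb' d) (t12 one12 x y) (c \<odot>\<^bsub>M3\<^esub> z)"
    using a x d c yz tLD(5)[of "a \<otimes>\<^bsub>A\<^esub> emb' d" c "t12 one12 x y" z]
    by (simp add: emb_simps shifts_closed emb_shifts A.m_assoc one_closed12 t12_closed)
qed

abbreviation "bwd a x v \<equiv>
  tensor_lift L (\<lambda>d. tensor_lift L (\<lambda>y z. tL (a \<otimes>\<^bsub>A\<^esub> emb' d) (t12 one12 x y) z)) v"

lemma bwd_additive: "\<lbrakk>a \<in> carrier A; x \<in> carrier M1\<rbrakk> \<Longrightarrow> additive_map F23 L (bwd a x)"
  by (rule P23.fusion_lift_additive[OF PL.fusion_abelian_group backward_inner_balanced])

lemma bwd_tensor:
  "\<lbrakk>a \<in> carrier A; x \<in> carrier M1; d \<in> carrier (TL m (N2 + N3)); y \<in> carrier M2; z \<in> carrier M3\<rbrakk> \<Longrightarrow>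
    bwd a x (t23 d y z) = tL (a \<otimes>\<^bsub>A\<^esub> emb' d) (t12 one12 x y) z"
  by (rule P23.fusion_lift_tensor[OF PL.fusion_abelian_group backward_inner_balanced])

text \<open>
  Here it is an element of \<open>TL\<^bsub>N1\<^esub>\<close> that has to be commuted past the image of \<open>d\<close>.
\<close>

lemma backward_balanced: "fusion_balanced m N1 (N2 + N3) M1 F23 L bwd"
proof (rule fusion_balancedI[OF sum_assoc])
  interpret R12: ring "TL m (N1 + N2)" by (rule TL_ring)
  interpret R23: ring "TL m (N2 + N3)" by (rule TL_ring)
  interpret M1: left_module "TL m N1" M1 by (rule left_module1)
  note ext = P23.fusion_ext[where Z = L]
  note sum = additive_add_functions[OF PL.fusion_abelian_group]
  show "additive_map F23 L (\<lambda>v. bwd a x v)" if "a \<in> carrier A" "x \<in> carrier M1" for a x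
    by (rule bwd_additive[OF that])
  show "additive_map A L (\<lambda>a. bwd a x v)" if x: "x \<in> carrier M1" and v: "v \<in> carrier F23" for x v
  proof (rule additiveI)
    fix a a' assume a: "a \<in> carrier A" "a' \<in> carrier A"
    show "bwd (a \<oplus>\<^bsub>A\<^esub> a') x v = bwd a x v \<oplus>\<^bsub>L\<^esub> bwd a' x v"
      by (rule ext[OF bwd_additive sum[OF bwd_additive bwd_additive] _ v])
        (use a x in \<open>simp_all add: bwd_tensor A.l_distr emb_simps t12_closed additive_add[OF tLD(1)]\<close>)
  qed (use that in \<open>simp add: additive_closed[OF bwd_additive]\<close>)
  show "additive_map M1 L (\<lambda>x. bwd a x v)" if a: "a \<in> carrier A" and v: "v \<in> carrier F23" for a v
  proof (rule additiveI)
    fix x x' assume x: "x \<in> carrier M1" "x' \<in> carrier M1"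
    show "bwd a (x \<oplus>\<^bsub>M1\<^esub> x') v = bwd a x v \<oplus>\<^bsub>L\<^esub> bwd a x' v"
      by (rule ext[OF bwd_additive sum[OF bwd_additive bwd_additive] _ v])
        (use a x in \<open>simp_all add: bwd_tensor emb_simps t12_closed additive_add[OF t12D(2)] additive_add[OF tLD(2)]\<close>)
  qed (use that in \<open>simp add: additive_closed[OF bwd_additive]\<close>)
  fix a x v assume a: "a \<in> carrier A" and x: "x \<in> carrier M1" and v: "v \<in> carrier F23"
  show "bwd (a \<otimes>\<^bsub>A\<^esub> emb' c) x v = bwd a x (c \<odot>\<^bsub>F23\<^esub> v)" if c: "c \<in> carrier (TL m (N2 + N3))" for c
    by (rule ext[OF bwd_additive additive_compose[OF P23.fusion_smult_additive bwd_additive] _ v])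
      (use a c x in \<open>simp_all add: bwd_tensor P23.fusion_smult_tensor emb_simps A.m_assoc\<close>)
  show "bwd (a \<otimes>\<^bsub>A\<^esub> TL_shift m 0 N1 (N1 + N2 + N3) c) x v = bwd a (c \<odot>\<^bsub>M1\<^esub> x) v"
    if c: "c \<in> carrier (TL m N1)" for c
  proof (rule ext[OF bwd_additive bwd_additive _ v])
    fix d y z assume dyz: "d \<in> carrier (TL m (N2 + N3))" "y \<in> carrier M2" "z \<in> carrier M3"
    let ?c = "TL_shift m 0 N1 (N1 + N2 + N3) c" and ?c' = "TL_shift m 0 N1 (N1 + N2) c"
    have "?c \<otimes>\<^bsub>A\<^esub> emb' d = emb' d \<otimes>\<^bsub>A\<^esub> ?c"
      by (rule TL_shift_commute) (use dyz c in simp_all)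
    then have "tL (a \<otimes>\<^bsub>A\<^esub> ?c \<otimes>\<^bsub>A\<^esub> emb' d) (t12 one12 x y) z =
        tL (a \<otimes>\<^bsub>A\<^esub> emb' d \<otimes>\<^bsub>A\<^esub> emb ?c') (t12 one12 x y) z"
      using a dyz c by (simp add: A.m_assoc emb_simps emb_shifts shifts_closed)
    also have "\<dots> = tL (a \<otimes>\<^bsub>A\<^esub> emb' d) (?c' \<odot>\<^bsub>F12\<^esub> t12 one12 x y) z"
      by (rule tLD(4)) (use a dyz c x in \<open>simp_all add: emb_simps shifts_closed t12_closed\<close>)
    also have "?c' \<odot>\<^bsub>F12\<^esub> t12 one12 x y = t12 one12 (c \<odot>\<^bsub>M1\<^esub> x) y"
      using dyz c x t12D(4)[of one12 c x y] by (simp add: P12.fusion_smult_tensor shifts_closed)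
    finally show "bwd (a \<otimes>\<^bsub>A\<^esub> ?c) x (t23 d y z) = bwd a (c \<odot>\<^bsub>M1\<^esub> x) (t23 d y z)"
      using a dyz c x by (simp add: bwd_tensor shifts_closed M1.smult_closed)
  qed (use a c x in \<open>simp_all add: shifts_closed M1.smult_closed\<close>)
qed

abbreviation "assoc_inv \<equiv> tensor_lift L (\<lambda>a. tensor_lift L (bwd a))"

lemma assoc_inv_additive: "additive_map Rt L assoc_inv"
  by (rule PR.fusion_lift_additive[OF PL.fusion_abelian_group backward_balanced])

lemma assoc_inv_tensor:
  assumes "a \<in> carrier A" "x \<in> carrier M1" "d \<in> carrier (TL m (N2 + N3))" "y \<in> carrier M2" "z \<in> carrier M3"
  shows "assoc_inv (tR a x (t23 d y z)) = tL (a \<otimes>\<^bsub>A\<^esub> emb' d) (t12 one12 x y) z"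
  using PR.fusion_lift_tensor[OF PL.fusion_abelian_group backward_balanced, unfolded sum_assoc] assms
  by (simp add: t23_closed bwd_tensor)

text \<open>
  The iterated fusion is generated additively by the elements \<open>a \<otimes> (b \<otimes> x \<otimes> y) \<otimes> z\<close>, and likewise on
  the other side.
\<close>

lemma left_ext:
  assumes f: "additive_map L Z f" and g: "additive_map L Z g"
    and eq: "\<And>a b x y z. \<lbrakk>a \<in> carrier A; b \<in> carrier (TL m (N1 + N2)); x \<in> carrier M1; y \<in> carrier M2; z \<in> carrier M3\<rbrakk>
      \<Longrightarrow> f (tL a (t12 b x y) z) = g (tL a (t12 b x y) z)"
    and v: "v \<in> carrier L"
  shows "f v = g v"
proof (rule PL.fusion_ext[OF f g _ v])
  fix a w z assume a: "a \<in> carrier A" and w: "w \<in> carrier F12" and z: "z \<in> carrier M3"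
  show "f (tL a w z) = g (tL a w z)"
    by (rule P12.fusion_ext[OF additive_compose[OF tLD(2)[OF a z] f] additive_compose[OF tLD(2)[OF a z] g] _ w])
      (use a z eq in simp)
qed

lemma right_ext:
  assumes f: "additive_map Rt Z f" and g: "additive_map Rt Z g"
    and eq: "\<And>a x d y z. \<lbrakk>a \<in> carrier A; x \<in> carrier M1; d \<in> carrier (TL m (N2 + N3)); y \<in> carrier M2; z \<in> carrier M3\<rbrakk>
      \<Longrightarrow> f (tR a x (t23 d y z)) = g (tR a x (t23 d y z))"
    and v: "v \<in> carrier Rt"
  shows "f v = g v"
proof (rule PR.fusion_ext[OF f g _ v, unfolded sum_assoc])
  fix a x w assume a: "a \<in> carrier A" and x: "x \<in> carrier M1" and w: "w \<in> carrier F23"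
  show "f (tR a x w) = g (tR a x w)"
    by (rule P23.fusion_ext[OF additive_compose[OF tRD(3)[OF a x] f] additive_compose[OF tRD(3)[OF a x] g] _ w])
      (use a x eq in simp)
qed

text \<open>
  The round trip turns \<open>a \<otimes> (b \<otimes> x \<otimes> y) \<otimes> z\<close> into \<open>ab \<otimes> (1 \<otimes> x \<otimes> y) \<otimes> z\<close>, which is the same element since
  \<open>b\<close> acts on the inner fusion.
\<close>

lemma assoc_inv_associator: "v \<in> carrier L \<Longrightarrow> assoc_inv (assoc v) = v"
proof (rule left_ext[OF additive_compose[OF associator_additive assoc_inv_additive] additive_id])
  interpret R12: ring "TL m (N1 + N2)" by (rule TL_ring)
  interpret R23: ring "TL m (N2 + N3)" by (rule TL_ring)
  fix a b x y z
  assume *: "a \<in> carrier A" "b \<in> carrier (TL m (N1 + N2))" "x \<in> carrier M1" "y \<in> carrier M2" "z \<in> carrier M3"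
  have "assoc_inv (assoc (tL a (t12 b x y) z)) = tL (a \<otimes>\<^bsub>A\<^esub> emb b) (t12 one12 x y) z"
    using * by (simp add: associator_tensor assoc_inv_tensor emb_simps)
  also have "\<dots> = tL a (b \<odot>\<^bsub>F12\<^esub> t12 one12 x y) z"
    by (rule tLD(4)) (use * in \<open>simp_all add: t12_closed\<close>)
  also have "\<dots> = tL a (t12 b x y) z"
    using * by (simp add: P12.fusion_smult_tensor)
  finally show "assoc_inv (assoc (tL a (t12 b x y) z)) = tL a (t12 b x y) z" .
qed

lemma associator_assoc_inv: "v \<in> carrier Rt \<Longrightarrow> assoc (assoc_inv v) = v"
proof (rule right_ext[OF additive_compose[OF assoc_inv_additive associator_additive] additive_id])
  interpret R12: ring "TL m (N1 + N2)" by (rule TL_ring)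
  interpret R23: ring "TL m (N2 + N3)" by (rule TL_ring)
  fix a x d y z
  assume *: "a \<in> carrier A" "x \<in> carrier M1" "d \<in> carrier (TL m (N2 + N3))" "y \<in> carrier M2" "z \<in> carrier M3"
  have "assoc (assoc_inv (tR a x (t23 d y z))) = tR (a \<otimes>\<^bsub>A\<^esub> emb' d) x (t23 one23 y z)"
    using * by (simp add: associator_tensor assoc_inv_tensor emb_simps)
  also have "\<dots> = tR a x (d \<odot>\<^bsub>F23\<^esub> t23 one23 y z)"
    by (rule tRD(5)) (use * in \<open>simp_all add: t23_closed\<close>)
  also have "\<dots> = tR a x (t23 d y z)"
    using * by (simp add: P23.fusion_smult_tensor)
  finally show "assoc (assoc_inv (tR a x (t23 d y z))) = tR a x (t23 d y z)" .
qed

lemmas right_left_module = PR.fusion_left_module[unfolded sum_assoc]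
lemmas right_smult_additive = PR.fusion_smult_additive[unfolded sum_assoc]
lemmas right_smult_tensor = PR.fusion_smult_tensor[unfolded sum_assoc]

lemma associator_smult:
  assumes s: "s \<in> carrier A" and v: "v \<in> carrier L"
  shows "assoc (s \<odot>\<^bsub>L\<^esub> v) = s \<odot>\<^bsub>Rt\<^esub> assoc v"
  by (rule left_ext[OF additive_compose[OF PL.fusion_smult_additive[OF s] associator_additive]
        additive_compose[OF associator_additive right_smult_additive[OF s]] _ v])
    (use s in \<open>simp add: PL.fusion_smult_tensor t12_closed associator_tensor right_smult_tensor
      one_closed23 t23_closed emb_simps A.m_assoc\<close>)

lemma associator_iso: "assoc \<in> left_module_iso A L Rt"
proof -
  have "bij_betw assoc (carrier L) (carrier Rt)"
    by (rule bij_betw_byWitness[where f' = assoc_inv])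
      (auto simp: assoc_inv_associator associator_assoc_inv additive_closed[OF associator_additive]
        additive_closed[OF assoc_inv_additive])
  then show ?thesis
    using associator_additive associator_smult
    by (simp add: left_module_iso_def left_module_hom_def additive_map_def)
qed

end

section \<open>Naturality\<close>

lemma fusion_map_hom:
  assumes M: "fusion_pair m N1 N2 M1 M2" and M': "fusion_pair m N1 N2 M1' M2'"
    and f: "f \<in> left_module_hom (TL m N1) M1 M1'" and g: "g \<in> left_module_hom (TL m N2) M2 M2'"
  shows "fusion_map m N1 N2 M1' M2' f g \<in>
    left_module_hom (TL m (N1 + N2)) (fusion m N1 N2 M1 M2) (fusion m N1 N2 M1' M2')"
proof -
  interpret M: fusion_pair m N1 N2 M1 M2 by fact
  interpret M': fusion_pair m N1 N2 M1' M2' by fact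
  interpret K: ring "TL m (N1 + N2)" by (rule TL_ring)
  note additive = fusion_map_additive[OF assms] and tensor = fusion_map_tensor[OF assms]
  note fg = additive_closed[OF left_module_hom_additive[OF f]] additive_closed[OF left_module_hom_additive[OF g]]
  have "fusion_map m N1 N2 M1' M2' f g (s \<odot>\<^bsub>fusion m N1 N2 M1 M2\<^esub> v) =
      s \<odot>\<^bsub>fusion m N1 N2 M1' M2'\<^esub> fusion_map m N1 N2 M1' M2' f g v"
    if "s \<in> carrier (TL m (N1 + N2))" "v \<in> carrier (fusion m N1 N2 M1 M2)" for s v
    by (rule M.fusion_ext[OF additive_compose[OF M.fusion_smult_additive additive]
          additive_compose[OF additive M'.fusion_smult_additive] _ that(2)])
      (use that in \<open>simp_all add: M.fusion_smult_tensor M'.fusion_smult_tensor tensor fg\<close>)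
  then show ?thesis
    using additive by (simp add: left_module_hom_def additive_map_def)
qed

lemma associator_natural:
  assumes M: "fusion_triple m N1 N2 N3 M1 M2 M3" and M': "fusion_triple m N1 N2 N3 M1' M2' M3'"
    and f1: "f1 \<in> left_module_hom (TL m N1) M1 M1'" and f2: "f2 \<in> left_module_hom (TL m N2) M2 M2'"
    and f3: "f3 \<in> left_module_hom (TL m N3) M3 M3'"
    and v: "v \<in> carrier (fusion m (N1 + N2) N3 (fusion m N1 N2 M1 M2) M3)"
  shows "associator m N1 N2 N3 M1' M2' M3'
      (fusion_map m (N1 + N2) N3 (fusion m N1 N2 M1' M2') M3' (fusion_map m N1 N2 M1' M2' f1 f2) f3 v) =
    fusion_map m N1 (N2 + N3) M1' (fusion m N2 N3 M2' M3') f1 (fusion_map m N2 N3 M2' M3' f2 f3)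
      (associator m N1 N2 N3 M1 M2 M3 v)"
proof -
  interpret M: fusion_triple m N1 N2 N3 M1 M2 M3 by fact
  interpret M': fusion_triple m N1 N2 N3 M1' M2' M3' by fact
  note fs = additive_closed[OF left_module_hom_additive[OF f1]] additive_closed[OF left_module_hom_additive[OF f2]]
    additive_closed[OF left_module_hom_additive[OF f3]]
  note hom12 = fusion_map_hom[OF M.P12.fusion_pair_axioms M'.P12.fusion_pair_axioms f1 f2]
  note hom23 = fusion_map_hom[OF M.P23.fusion_pair_axioms M'.P23.fusion_pair_axioms f2 f3]
  note map12 = fusion_map_tensor[OF M.P12.fusion_pair_axioms M'.P12.fusion_pair_axioms f1 f2]
  note map23 = fusion_map_tensor[OF M.P23.fusion_pair_axioms M'.P23.fusion_pair_axioms f2 f3]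
  note mapL = fusion_map_additive[OF M.PL.fusion_pair_axioms M'.PL.fusion_pair_axioms hom12 f3]
    fusion_map_tensor[OF M.PL.fusion_pair_axioms M'.PL.fusion_pair_axioms hom12 f3]
  note mapR = fusion_map_additive[OF M.PR.fusion_pair_axioms M'.PR.fusion_pair_axioms f1 hom23]
    fusion_map_tensor[OF M.PR.fusion_pair_axioms M'.PR.fusion_pair_axioms f1 hom23, unfolded M.sum_assoc]
  show ?thesis
  proof (rule M.left_ext[OF additive_compose[OF mapL(1) M'.associator_additive]
        additive_compose[OF M.associator_additive mapR(1)] _ v])
    fix a b x y z
    assume *: "a \<in> carrier M.A" "b \<in> carrier (TL m (N1 + N2))" "x \<in> carrier M1" "y \<in> carrier M2" "z \<in> carrier M3"
    show "M'.assoc (fusion_map m (N1 + N2) N3 (fusion m N1 N2 M1' M2') M3'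
          (fusion_map m N1 N2 M1' M2' f1 f2) f3 (M.tL a (M.t12 b x y) z)) =
        fusion_map m N1 (N2 + N3) M1' (fusion m N2 N3 M2' M3') f1 (fusion_map m N2 N3 M2' M3' f2 f3)
          (M.assoc (M.tL a (M.t12 b x y) z))"
      using * by (simp add: mapL(2) mapR(2) map12 map23 fs M.associator_tensor M'.associator_tensor
          M.t12_closed M.t23_closed M.one_closed23 M.emb_simps)
  qed
qed

theorem proposition5p4p1:
  fixes q m :: complex
    and N1 N2 N3 :: nat
    and M1 :: "(tl, 'x) module" and M2 :: "(tl, 'y) module" and M3 :: "(tl, 'z) module"
  assumes "q \<noteq> 0" and "m = q + inverse q"
    and "N1 \<ge> 1" and "N2 \<ge> 1" and "N3 \<ge> 1"
    and "left_module (TL m N1) M1" and "left_module (TL m N2) M2" and "left_module (TL m N3) M3"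
  shows
    "left_module (TL m (N1 + N2 + N3)) (fusion m (N1 + N2) N3 (fusion m N1 N2 M1 M2) M3) \<and>
     left_module (TL m (N1 + N2 + N3)) (fusion m N1 (N2 + N3) M1 (fusion m N2 N3 M2 M3)) \<and>
     associator m N1 N2 N3 M1 M2 M3 \<in>
       left_module_iso (TL m (N1 + N2 + N3))
         (fusion m (N1 + N2) N3 (fusion m N1 N2 M1 M2) M3)
         (fusion m N1 (N2 + N3) M1 (fusion m N2 N3 M2 M3)) \<and>
     (\<forall>a\<in>carrier (TL m (N1 + N2 + N3)). \<forall>b\<in>carrier (TL m (N1 + N2)).
      \<forall>x\<in>carrier M1. \<forall>y\<in>carrier M2. \<forall>z\<in>carrier M3.
        associator m N1 N2 N3 M1 M2 M3
          (fusion_tensor m (N1 + N2) N3 (fusion m N1 N2 M1 M2) M3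
             a (fusion_tensor m N1 N2 M1 M2 b x y) z) =
        fusion_tensor m N1 (N2 + N3) M1 (fusion m N2 N3 M2 M3)
          (a \<otimes>\<^bsub>TL m (N1 + N2 + N3)\<^esub> TL_embed m (N1 + N2) (N1 + N2 + N3) b)
          x (fusion_tensor m N2 N3 M2 M3 \<one>\<^bsub>TL m (N2 + N3)\<^esub> y z)) \<and>
     (\<forall>(M1' :: (tl, 'x2) module) (M2' :: (tl, 'y2) module) (M3' :: (tl, 'z2) module).
      \<forall>f1\<in>left_module_hom (TL m N1) M1 M1'.
      \<forall>f2\<in>left_module_hom (TL m N2) M2 M2'.
      \<forall>f3\<in>left_module_hom (TL m N3) M3 M3'.
        left_module (TL m N1) M1' \<longrightarrow> left_module (TL m N2) M2' \<longrightarrow> left_module (TL m N3) M3' \<longrightarrow>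
        (\<forall>v\<in>carrier (fusion m (N1 + N2) N3 (fusion m N1 N2 M1 M2) M3).
           associator m N1 N2 N3 M1' M2' M3'
             (fusion_map m (N1 + N2) N3 (fusion m N1 N2 M1' M2') M3'
                (fusion_map m N1 N2 M1' M2' f1 f2) f3 v) =
           fusion_map m N1 (N2 + N3) M1' (fusion m N2 N3 M2' M3')
             f1 (fusion_map m N2 N3 M2' M3' f2 f3) (associator m N1 N2 N3 M1 M2 M3 v)))"
proof -
  interpret M: fusion_triple m N1 N2 N3 M1 M2 M3
    using assms(6-8) by (rule fusion_triple.intro)
  show ?thesis
    using M.PL.fusion_left_module M.right_left_module M.associator_iso M.associator_tensor
      associator_natural[OF M.fusion_triple_axioms fusion_triple.intro]
    by blast
qed

end
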